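(* Let $X=W/\langle f\rangle$ be a Hopf manifold of dimension $n\ge 3$, where $f(z_1,\dots,z_n)=(\mu_1z_1,\dots,\mu_nz_n)$, and let $\mathcal F$ be a nonsingular codimension-one holomorphic distribution on $X$ given by a morphism $\mathcal N^*_{\mathcal F}=L_b\to\Omega^1_X$, $b\in\mathbb C^*$. Then the following holds. (i) If $X$ is classical (with $\mu_1=\dots=\mu_n=\mu$), then $b^{-1}=\mu^m$ with $m\in\mathbb N$, $m\ge1$. Furthermore $\mathcal F$ is induced by a polynomial $1$-form $\omega=g_1dz_1+\dots+g_ndz_n$, where the $g_i$ are homogeneous polynomials of the same degree $m-1$ for all $1\le i\le n$, with $\{g_1=\dots=g_n=0\}=\{0\}$. (ii) If $X$ is generic, then $b^{-1}=\mu_j$ for some $j\in\{1,\dots,n\}$, and $\mathcal F$ is induced by the $1$-form $\omega=dz_j$. (iii) If $X$ is intermediary (with $\mu_1=\dots=\mu_r$, $2\le r\le n-1$), then $b^{-1}\in\{\mu_1,\mu_{r+1},\mu_{r+2},\dots,\mu_n\}$, and $\mathcal F$ is induced by a constant $1$-form (a $1$-form $\sum c^idz_i$ with $c^i\in\mathbb C$).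
   Context: Let $W=\mathbb C^n\setminus\{0\}$ and $f(z_1,\dots,z_n)=(\mu_1z_1,\dots,\mu_nz_n)$ with $0<|\mu_i|<1$ for all $i$. The compact complex manifold $X=W/\langle f\rangle$ is called a Hopf manifold. Types of Hopf manifolds. $X$ is classical if $\mu_1=\dots=\mu_n=:\mu$. $X$ is generic if $0<|\mu_1|\le\dots\le|\mu_n|<1$ and there is no non-trivial relation $\prod_{i\in A}\mu_i^{r_i}=\prod_{j\in B}\mu_j^{r_j}$ with $r_i,r_j\in\mathbb N$, $A\cap B=\emptyset$, $A\cup B=\{1,\dots,n\}$. $X$ is intermediary if $\mu_1=\dots=\mu_r$ for some $2\le r\le n-1$ and there is no non-trivial relation $\prod_{i\in A}\mu_i^{r_i}=\prod_{j\in B}\mu_j^{r_j}$ with $r_i,r_j\in\mathbb N$, $A\cap B=\emptyset$, $A\cup B=\{1,r+1,\dots,n\}$. For $b\in\mathbb C^*$, $L_b$ is the line bundle on $X$ obtained as the quotient of $W\times\mathbb C$ by $(z,v)\mapsto(f(z),bv)$; every line bundle on $X$ is of this form. A nonsingular codimension-one distribution $\mathcal F$ on $X$ (integrability is not assumed) is given by a line bundle $\mathcal N^*_{\mathcal F}=L_b$ (the conormal bundle) and an embedding of vector bundles $L_b\to\Omega^1_X$, i.e. a nowhere vanishing section of $\Omega^1_X\otimes L_{b^{-1}}$. Such a section corresponds to a holomorphic $1$-form $\omega=\sum_k g_k\,dz_k$ on $W$ with $g_k(f(z))=\mu_k^{-1}b^{-1}g_k(z)$ for all $k$; one says that $\mathcal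 F$ is induced by $\omega$.
   Formalization: In (i), {g_1=…=g_n=0}={0} is proved for m≥2; for m=1 only the inclusion in {0} is stated, since then the g_i are constants, not all zero, and the common zero set is empty (e.g. ω=dz_1, b^{-1}=μ). *)

theory Defs
  imports "HOL-Analysis.Analysis"
begin

(* Quotients by the cyclic group generated by a bijection T of S. Since T is invertible,
   iterates with natural exponents in both directions describe the whole orbit. *)
definition orbit_rel :: "'a set \<Rightarrow> ('a \<Rightarrow> 'a) \<Rightarrow> ('a \<times> 'a) set" where
  "orbit_rel S T = {(x, y). x \<in> S \<and> y \<in> S \<and> (\<exists>k. y = (T ^^ k) x \<or> x = (T ^^ k) y)}"

definition punctured :: "(complex ^ 'n) set" where
  "punctured = UNIV - {0}"

definition hopf_multipliers :: "complex ^ 'n \<Rightarrow> bool" where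
  "hopf_multipliers \<mu> \<longleftrightarrow> (\<forall>i. 0 < norm (\<mu> $ i) \<and> norm (\<mu> $ i) < 1)"

definition hopf_map :: "complex ^ 'n \<Rightarrow> complex ^ 'n \<Rightarrow> complex ^ 'n" where
  "hopf_map \<mu> z = (\<chi> i. \<mu> $ i * z $ i)"

definition hopf_manifold :: "complex ^ 'n \<Rightarrow> (complex ^ 'n) set set" where
  "hopf_manifold \<mu> = punctured // orbit_rel punctured (hopf_map \<mu>)"

definition hopf_pt :: "complex ^ 'n \<Rightarrow> complex ^ 'n \<Rightarrow> (complex ^ 'n) set" where
  "hopf_pt \<mu> z = orbit_rel punctured (hopf_map \<mu>) `` {z}"

(* The charts of the Hopf manifold are the local inverses of the covering hopf_pt;
   U is the image of such a chart, whose domain contains the point x. *)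
definition chart_around :: "complex ^ 'n \<Rightarrow> (complex ^ 'n) set \<Rightarrow> (complex ^ 'n) set \<Rightarrow> bool" where
  "chart_around \<mu> x U \<longleftrightarrow>
     open U \<and> U \<subseteq> punctured \<and> inj_on (hopf_pt \<mu>) U \<and> x \<in> hopf_pt \<mu> ` U"

(* The flat vector bundle with fibre 'v: quotient of the trivial bundle on the punctured
   space by (z, v) |-> (hopf_map z, A v), where A is a linear automorphism of 'v. *)
definition bundle_rel ::
  "complex ^ 'n \<Rightarrow> ('v \<Rightarrow> 'v) \<Rightarrow> (((complex ^ 'n) \<times> 'v) \<times> ((complex ^ 'n) \<times> 'v)) set" where
  "bundle_rel \<mu> A = orbit_rel (punctured \<times> UNIV) (map_prod (hopf_map \<mu>) A)"

definition vector_bundle :: "complex ^ 'n \<Rightarrow> ('v \<Rightarrow> 'v) \<Rightarrow> ((complex ^ 'n) \<times> 'v) set set" where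
  "vector_bundle \<mu> A = (punctured \<times> UNIV) // bundle_rel \<mu> A"

definition bundle_pt ::
  "complex ^ 'n \<Rightarrow> ('v \<Rightarrow> 'v) \<Rightarrow> complex ^ 'n \<Rightarrow> 'v \<Rightarrow> ((complex ^ 'n) \<times> 'v) set" where
  "bundle_pt \<mu> A z v = bundle_rel \<mu> A `` {(z, v)}"

definition line_bundle :: "complex ^ 'n \<Rightarrow> complex \<Rightarrow> ((complex ^ 'n) \<times> complex) set set" where
  "line_bundle \<mu> b = vector_bundle \<mu> (\<lambda>v. b * v)"

definition line_pt ::
  "complex ^ 'n \<Rightarrow> complex \<Rightarrow> complex ^ 'n \<Rightarrow> complex \<Rightarrow> ((complex ^ 'n) \<times> complex) set" where
  "line_pt \<mu> b z v = bundle_pt \<mu> (\<lambda>v. b * v) z v"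

(* The tangent bundle is glued by the derivative of hopf_map, which is hopf_map itself. *)
definition tangent_pt ::
  "complex ^ 'n \<Rightarrow> complex ^ 'n \<Rightarrow> complex ^ 'n \<Rightarrow> ((complex ^ 'n) \<times> (complex ^ 'n)) set" where
  "tangent_pt \<mu> z v = bundle_pt \<mu> (hopf_map \<mu>) z v"

(* The cotangent bundle is glued by the inverse transpose of that derivative; a covector
   sum_k xi_k dz_k is represented by its vector of components xi. *)
definition cotangent_pt ::
  "complex ^ 'n \<Rightarrow> complex ^ 'n \<Rightarrow> complex ^ 'n \<Rightarrow> ((complex ^ 'n) \<times> (complex ^ 'n)) set" where
  "cotangent_pt \<mu> z \<xi> = bundle_pt \<mu> (\<lambda>\<eta>. \<chi> k. inverse (\<mu> $ k) * \<eta> $ k) z \<xi>"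

definition covector_apply :: "complex ^ 'n \<Rightarrow> complex ^ 'n \<Rightarrow> complex" where
  "covector_apply \<xi> v = (\<Sum>k\<in>UNIV. \<xi> $ k * v $ k)"

(* Several complex variables: real Frechet differentiable with complex-linear derivative.
   Used for open U only. A 1-form sum_k g_k dz_k is represented by z |-> (g_k z)_k. *)
definition holomorphic_map_on ::
  "(complex ^ 'n \<Rightarrow> complex ^ 'm) \<Rightarrow> (complex ^ 'n) set \<Rightarrow> bool" where
  "holomorphic_map_on g U \<longleftrightarrow>
     (\<forall>z\<in>U. \<exists>D. (g has_derivative D) (at z) \<and> (\<forall>c v. D (c *s v) = c *s D v))"

(* line_bundle \<mu> b is L_b. Holomorphic morphisms from it to the cotangent bundle: over every chart, with respect to
   the trivialisations (z, v) |-> [z, v], they are multiplication by a holomorphic column h.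
   In particular they cover the identity of the Hopf manifold and are linear on fibres. *)
definition line_to_cotangent_morphism ::
  "complex ^ 'n \<Rightarrow> complex \<Rightarrow>
     (((complex ^ 'n) \<times> complex) set \<Rightarrow> ((complex ^ 'n) \<times> (complex ^ 'n)) set) \<Rightarrow> bool" where
  "line_to_cotangent_morphism \<mu> b \<Phi> \<longleftrightarrow>
     (\<forall>x\<in>hopf_manifold \<mu>. \<exists>U h. chart_around \<mu> x U \<and> holomorphic_map_on h U \<and>
        (\<forall>z\<in>U. \<forall>v. \<Phi> (line_pt \<mu> b z v) = cotangent_pt \<mu> z (v *s h z)))"

(* As morphisms cover the identity, injectivity on the total space is fibrewise injectivity. *)
definition line_to_cotangent_embedding ::
  "complex ^ 'n \<Rightarrow> complex \<Rightarrow>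
     (((complex ^ 'n) \<times> complex) set \<Rightarrow> ((complex ^ 'n) \<times> (complex ^ 'n)) set) \<Rightarrow> bool" where
  "line_to_cotangent_embedding \<mu> b \<Phi> \<longleftrightarrow>
     line_to_cotangent_morphism \<mu> b \<Phi> \<and> inj_on \<Phi> (line_bundle \<mu> b)"

(* F is the subset of the tangent bundle annihilated by the image of Phi. *)
definition distribution_given_by ::
  "complex ^ 'n \<Rightarrow> complex \<Rightarrow>
     (((complex ^ 'n) \<times> complex) set \<Rightarrow> ((complex ^ 'n) \<times> (complex ^ 'n)) set) \<Rightarrow>
     ((complex ^ 'n) \<times> (complex ^ 'n)) set set \<Rightarrow> bool" where
  "distribution_given_by \<mu> b \<Phi> F \<longleftrightarrow>
     line_to_cotangent_embedding \<mu> b \<Phi> \<and>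
     F = {tangent_pt \<mu> z v | z v. z \<in> punctured \<and>
            (\<exists>\<xi>. \<Phi> (line_pt \<mu> b z 1) = cotangent_pt \<mu> z \<xi> \<and> covector_apply \<xi> v = 0)}"

(* omega corresponds to a nowhere vanishing section of Omega^1 (x) L_{1/b}, and F is the
   distribution of its kernels. Note that F determines omega only up to a nonzero constant. *)
definition induced_by ::
  "complex ^ 'n \<Rightarrow> complex \<Rightarrow> ((complex ^ 'n) \<times> (complex ^ 'n)) set set \<Rightarrow>
     (complex ^ 'n \<Rightarrow> complex ^ 'n) \<Rightarrow> bool" where
  "induced_by \<mu> b F \<omega> \<longleftrightarrow>
     holomorphic_map_on \<omega> punctured \<and>
     (\<forall>z\<in>punctured. \<omega> z \<noteq> 0) \<and>
     (\<forall>z\<in>punctured. \<forall>k. \<omega> (hopf_map \<mu> z) $ k = inverse (\<mu> $ k) * inverse b * \<omega> z $ k) \<and>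
     F = {tangent_pt \<mu> z v | z v. z \<in> punctured \<and> covector_apply (\<omega> z) v = 0}"

(* As usual, the zero polynomial is homogeneous of every degree. *)
definition homogeneous_polynomial :: "nat \<Rightarrow> (complex ^ 'n \<Rightarrow> complex) \<Rightarrow> bool" where
  "homogeneous_polynomial d p \<longleftrightarrow>
     (\<exists>c :: ('n \<Rightarrow> nat) \<Rightarrow> complex. \<forall>z.
        p z = (\<Sum>\<alpha> | (\<Sum>i\<in>UNIV. \<alpha> i) = d. c \<alpha> * (\<Prod>i\<in>UNIV. (z $ i) ^ \<alpha> i)))"

(* The index type is linearly ordered, so its elements are numbered 1, ..., n. *)
definition index_number :: "'n::{finite,linorder} \<Rightarrow> nat" where
  "index_number i = card {j. j \<le> i}"

(* Exponents may be 0; a relation is trivial when all its exponents are. *)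
definition no_nontrivial_relation :: "complex ^ 'n \<Rightarrow> 'n set \<Rightarrow> bool" where
  "no_nontrivial_relation \<mu> J \<longleftrightarrow>
     \<not> (\<exists>A B (r :: 'n \<Rightarrow> nat). A \<inter> B = {} \<and> A \<union> B = J \<and> (\<exists>i\<in>J. r i \<noteq> 0) \<and>
          (\<Prod>i\<in>A. (\<mu> $ i) ^ r i) = (\<Prod>j\<in>B. (\<mu> $ j) ^ r j))"

definition classical_hopf :: "complex ^ 'n \<Rightarrow> complex \<Rightarrow> bool" where
  "classical_hopf \<mu> c \<longleftrightarrow> (\<forall>i. \<mu> $ i = c)"

definition generic_hopf :: "complex ^ 'n::{finite,linorder} \<Rightarrow> bool" where
  "generic_hopf \<mu> \<longleftrightarrow>
     (\<forall>i j. i \<le> j \<longrightarrow> norm (\<mu> $ i) \<le> norm (\<mu> $ j)) \<and> no_nontrivial_relation \<mu> UNIV"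

(* The indices 1, r+1, ..., n. *)
definition reduced_indices :: "nat \<Rightarrow> 'n::{finite,linorder} set" where
  "reduced_indices r = {i. index_number i = 1 \<or> r + 1 \<le> index_number i}"

definition intermediary_hopf :: "complex ^ 'n::{finite,linorder} \<Rightarrow> nat \<Rightarrow> bool" where
  "intermediary_hopf \<mu> r \<longleftrightarrow>
     2 \<le> r \<and> r \<le> CARD('n) - 1 \<and>
     (\<forall>i j. index_number i \<le> r \<longrightarrow> index_number j \<le> r \<longrightarrow> \<mu> $ i = \<mu> $ j) \<and>
     no_nontrivial_relation \<mu> (reduced_indices r)"

end

theory Submission
  imports Defs "HOL-Complex_Analysis.Cauchy_Integral_Formula"
begin

text \<open>
  The morphism that defines the distribution lifts to a nowhere vanishing holomorphic form
  \<open>\<omega> = \<Sum> g\<^sub>k dz\<^sub>k\<close> on the punctured space whose components are eigenvectors of the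
  composition with the contraction: \<open>g\<^sub>k \<circ> f = (\<mu>\<^sub>k b)\<^sup>-\<^sup>1 g\<^sub>k\<close>
  (\<open>inducing_form_exists\<close>). The proof determines all such eigenvectors and then asks which forms
  built from them have no zero.

  An eigenvector grows at most like a power of the norm, because the contraction carries the
  complement of the unit ball into a compact annulus in logarithmically many steps
  (\<open>equivariant_polynomial_growth\<close>). By Liouville's theorem it is therefore a polynomial of
  bounded degree on each line parallel to an axis that avoids the origin, and Lagrange interpolation
  in one variable after the other shows that it is a polynomial (\<open>tensor_interpolation\<close>).
  Monomials are eigenvectors with eigenvalue \<open>\<mu>\<^sup>\<alpha>\<close>, so only terms \<open>z\<^sup>\<alpha> dz\<^sub>k\<close> with
  \<open>\<mu>\<^sup>\<alpha> \<mu>\<^sub>k = b\<^sup>-\<^sup>1\<close> occur (\<open>equivariant_component_expansion\<close>).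

  If all multipliers are equal, this condition fixes the degree of \<open>\<alpha>\<close>, which is the classical
  case. In the other cases the indices fall into classes with equal multipliers, and the multipliers
  of different classes are multiplicatively independent. Then all terms have the same multidegree
  \<open>\<gamma>\<close> with respect to the classes, where \<open>dz\<^sub>k\<close> counts like \<open>z\<^sub>k\<close>
  (\<open>form_expansion_class_degree\<close>). If the total degree of \<open>\<gamma>\<close> were at least two, the
  form would have a zero: on a coordinate axis outside two classes that together carry degree
  at least two, or, when there are only two classes, as a zero of a linear form in at least two
  variables (\<open>total_degree_one_three_classes\<close>, \<open>total_degree_one_two_classes\<close>). So the
  total degree is one, the form is constant, and \<open>b\<^sup>-\<^sup>1\<close> is one of the multipliers.
\<close>

section \<open>Orbits of the contraction and points of the bundles\<close>

text \<open>
  The orbits of the group generated by \<^term>\<open>T\<close> are described by natural exponents in both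
  directions; injectivity of \<^term>\<open>T\<close> is what allows common powers to be cancelled, which
  is the content of transitivity.
\<close>

lemma equiv_orbit_rel:
  assumes "inj T"
  shows "equiv S (orbit_rel S T)"
proof (rule equivI)
  have cancel: "\<exists>k. x = (T ^^ k) z \<or> z = (T ^^ k) x" if "(T ^^ k) x = (T ^^ l) z" for k l x z
  proof -
    have inj: "inj (T ^^ j)" for j
      using assms by (rule inj_fn)
    show ?thesis
    proof (cases "k \<le> l")
      case True
      then have "(T ^^ k) x = (T ^^ k) ((T ^^ (l - k)) z)"
        using that by (simp flip: funpow_add comp_apply[of "T ^^ k"])
      then show ?thesis using inj[of k] by (auto dest: injD)
    next
      case False
      then have "(T ^^ l) z = (T ^^ l) ((T ^^ (k - l)) x)"
        using that by (simp flip: funpow_add comp_apply[of "T ^^ l"])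
      then show ?thesis using inj[of l] by (auto dest: injD)
    qed
  qed
  show "orbit_rel S T \<subseteq> S \<times> S"
    by (auto simp: orbit_rel_def)
  show "refl_on S (orbit_rel S T)"
    by (auto simp: orbit_rel_def refl_on_def intro: exI[of _ 0])
  show "sym (orbit_rel S T)"
    by (auto simp: orbit_rel_def sym_def)
  show "trans (orbit_rel S T)"
  proof (rule transI)
    fix x y z assume "(x, y) \<in> orbit_rel S T" "(y, z) \<in> orbit_rel S T"
    then obtain k l where S: "x \<in> S" "z \<in> S"
      and k: "y = (T ^^ k) x \<or> x = (T ^^ k) y" and l: "z = (T ^^ l) y \<or> y = (T ^^ l) z"
      by (auto simp: orbit_rel_def)
    from k l have "\<exists>j. z = (T ^^ j) x \<or> x = (T ^^ j) z"
    proof (elim disjE)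
      assume "y = (T ^^ k) x" "z = (T ^^ l) y"
      then have "z = (T ^^ (l + k)) x" by (simp add: funpow_add)
      then show ?thesis by blast
    next
      assume "y = (T ^^ k) x" "y = (T ^^ l) z"
      then show ?thesis using cancel[of k x l z] by auto
    next
      assume "x = (T ^^ k) y" "z = (T ^^ l) y"
      then have "(T ^^ l) x = (T ^^ k) z"
        by (simp flip: funpow_add comp_apply[of "T ^^ k"] comp_apply[of "T ^^ l"] add: add.commute)
      then show ?thesis using cancel[of l x k z] by auto
    next
      assume "x = (T ^^ k) y" "y = (T ^^ l) z"
      then have "x = (T ^^ (k + l)) z" by (simp add: funpow_add)
      then show ?thesis by blast
    qed
    then show "(x, z) \<in> orbit_rel S T"
      using S by (simp add: orbit_rel_def)
  qed
qed

lemma orbit_class_eq_iff: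
  assumes "inj T" "x \<in> S" "y \<in> S"
  shows "orbit_rel S T `` {x} = orbit_rel S T `` {y} \<longleftrightarrow> (\<exists>k. y = (T ^^ k) x \<or> x = (T ^^ k) y)"
  using eq_equiv_class_iff[OF equiv_orbit_rel[OF assms(1), of S] assms(2,3)] assms(2,3)
  by (simp add: orbit_rel_def)

lemma hopf_map_nth [simp]: "hopf_map \<mu> z $ i = \<mu> $ i * z $ i"
  by (simp add: hopf_map_def)

lemma funpow_hopf_map_nth: "((hopf_map \<mu> ^^ k) z) $ i = (\<mu> $ i) ^ k * z $ i"
  by (induction k) auto

lemma hopf_multipliers_nonzero: "hopf_multipliers \<mu> \<Longrightarrow> \<mu> $ i \<noteq> 0"
  by (auto simp: hopf_multipliers_def)

lemma inj_hopf_map: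
  assumes "\<And>i. \<mu> $ i \<noteq> 0"
  shows "inj (hopf_map \<mu>)"
  using assms by (auto intro!: injI simp: vec_eq_iff)

lemma hopf_map_in_punctured:
  assumes "\<And>i. \<mu> $ i \<noteq> 0" "z \<in> punctured"
  shows "hopf_map \<mu> z \<in> punctured"
  using assms by (auto simp: punctured_def vec_eq_iff)

lemma open_punctured: "open (punctured :: (complex ^ 'n) set)"
  by (auto simp: punctured_def intro: open_delete)

lemma funpow_map_prod:
  fixes S :: "'a \<Rightarrow> 'a" and T :: "'b \<Rightarrow> 'b"
  shows "(map_prod S T ^^ k) (x, y) = ((S ^^ k) x, (T ^^ k) y)"
  by (induction k) auto

lemma bundle_pt_eq_iff:
  assumes "hopf_multipliers \<mu>" "inj A" "z \<in> punctured" "w \<in> punctured"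
  shows "bundle_pt \<mu> A z v = bundle_pt \<mu> A w u \<longleftrightarrow>
    (\<exists>k. w = (hopf_map \<mu> ^^ k) z \<and> u = (A ^^ k) v \<or> z = (hopf_map \<mu> ^^ k) w \<and> v = (A ^^ k) u)"
proof -
  have "inj (map_prod (hopf_map \<mu>) A)"
    using assms(2) inj_hopf_map[OF hopf_multipliers_nonzero[OF assms(1)]] by (simp add: prod.inj_map)
  then show ?thesis
    using assms(3,4)
    by (simp add: bundle_pt_def bundle_rel_def orbit_class_eq_iff funpow_map_prod)
qed

lemma bundle_pt_step:
  assumes "hopf_multipliers \<mu>" "inj A" "z \<in> punctured"
  shows "bundle_pt \<mu> A (hopf_map \<mu> z) (A v) = bundle_pt \<mu> A z v"
  using assms hopf_map_in_punctured[OF hopf_multipliers_nonzero[OF assms(1)] assms(3)]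
  by (subst bundle_pt_eq_iff) (auto intro!: exI[of _ 1])

lemma funpow_hopf_map_fixed_point:
  assumes "hopf_multipliers \<mu>" "z \<in> punctured" "z = (hopf_map \<mu> ^^ k) z"
  shows "k = 0"
proof (rule ccontr)
  assume "k \<noteq> 0"
  from assms(2) obtain i where i: "z $ i \<noteq> 0"
    by (auto simp: punctured_def vec_eq_iff)
  have "z $ i = (\<mu> $ i) ^ k * z $ i"
    using assms(3) funpow_hopf_map_nth by metis
  then have "norm (\<mu> $ i) ^ k = 1"
    using i by (simp flip: norm_power)
  moreover have "norm (\<mu> $ i) ^ k < 1"
    using assms(1) \<open>k \<noteq> 0\<close> by (simp add: hopf_multipliers_def power_less_one_iff)
  ultimately show False by simp
qed

text \<open>
  The group generated by the contraction acts freely on the base, so a point of the quotient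
  bundle has only one representative over each point of the covering space.
\<close>

lemma bundle_pt_inject:
  assumes "hopf_multipliers \<mu>" "inj A" "z \<in> punctured"
  shows "bundle_pt \<mu> A z v = bundle_pt \<mu> A z u \<longleftrightarrow> v = u"
proof
  assume "bundle_pt \<mu> A z v = bundle_pt \<mu> A z u"
  then obtain k where k: "z = (hopf_map \<mu> ^^ k) z" "u = (A ^^ k) v \<or> v = (A ^^ k) u"
    using assms by (auto simp: bundle_pt_eq_iff)
  then show "v = u"
    using funpow_hopf_map_fixed_point[OF assms(1,3) k(1)] by auto
qed simp

lemma inj_cotangent_action:
  assumes "hopf_multipliers \<mu>"
  shows "inj (\<lambda>\<eta> :: complex ^ 'n. \<chi> k. inverse (\<mu> $ k) * \<eta> $ k)"
  using hopf_multipliers_nonzero[OF assms] by (auto intro!: injI simp: vec_eq_iff)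

lemma cotangent_pt_inject:
  assumes "hopf_multipliers \<mu>" "z \<in> punctured"
  shows "cotangent_pt \<mu> z \<xi> = cotangent_pt \<mu> z \<eta> \<longleftrightarrow> \<xi> = \<eta>"
  unfolding cotangent_pt_def by (rule bundle_pt_inject[OF assms(1) inj_cotangent_action[OF assms(1)] assms(2)])

lemma cotangent_pt_step:
  assumes "hopf_multipliers \<mu>" "z \<in> punctured"
  shows "cotangent_pt \<mu> (hopf_map \<mu> z) (\<chi> k. inverse (\<mu> $ k) * \<xi> $ k) = cotangent_pt \<mu> z \<xi>"
  unfolding cotangent_pt_def
  by (rule bundle_pt_step[OF assms(1) inj_cotangent_action[OF assms(1)] assms(2)])

lemma inj_scale: "c \<noteq> 0 \<Longrightarrow> inj (\<lambda>v :: complex. c * v)"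
  by (auto intro: injI)

lemma line_pt_inject:
  assumes "hopf_multipliers \<mu>" "b \<noteq> 0" "z \<in> punctured"
  shows "line_pt \<mu> b z v = line_pt \<mu> b z u \<longleftrightarrow> v = u"
  unfolding line_pt_def by (rule bundle_pt_inject[OF assms(1) inj_scale[OF assms(2)] assms(3)])

lemma line_pt_step:
  assumes "hopf_multipliers \<mu>" "b \<noteq> 0" "z \<in> punctured"
  shows "line_pt \<mu> b (hopf_map \<mu> z) (b * v) = line_pt \<mu> b z v"
  unfolding line_pt_def by (rule bundle_pt_step[OF assms(1) inj_scale[OF assms(2)] assms(3)])

lemma line_pt_in_line_bundle: "z \<in> punctured \<Longrightarrow> line_pt \<mu> b z v \<in> line_bundle \<mu> b"
  by (auto simp: line_pt_def line_bundle_def bundle_pt_def vector_bundle_def intro: quotientI)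

section \<open>The holomorphic form induced on the covering space\<close>

lemma hopf_map_inverse:
  assumes "\<And>i. \<mu> $ i \<noteq> 0"
  shows "hopf_map \<mu> (hopf_map (\<chi> i. inverse (\<mu> $ i)) z) = z"
    "hopf_map (\<chi> i. inverse (\<mu> $ i)) (hopf_map \<mu> z) = z"
  using assms by (auto simp: vec_eq_iff)

lemma bounded_linear_hopf_map: "bounded_linear (hopf_map \<mu>)"
  by (auto intro!: linear_conv_bounded_linear[THEN iffD1] linearI simp: vec_eq_iff algebra_simps)

lemma hopf_map_scale: "hopf_map \<mu> (c *s v) = c *s hopf_map \<mu> v"
  by (simp add: vec_eq_iff)

text \<open>
  Columns over different points of one orbit differ by the diagonal action on the base and on the
  fibres, so this is what makes holomorphy independent of the chosen point of the orbit.
\<close>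

lemma holomorphic_map_on_diagonal_conjugate:
  assumes "holomorphic_map_on h U"
  shows "holomorphic_map_on (\<lambda>z. hopf_map \<alpha> (h (hopf_map \<beta> z))) (hopf_map \<beta> -` U)"
  unfolding holomorphic_map_on_def
proof
  fix z assume "z \<in> hopf_map \<beta> -` U"
  then obtain D where D: "(h has_derivative D) (at (hopf_map \<beta> z))" "\<And>c v. D (c *s v) = c *s D v"
    using assms by (auto simp: holomorphic_map_on_def)
  have "((\<lambda>z. hopf_map \<alpha> (h (hopf_map \<beta> z))) has_derivative (\<lambda>v. hopf_map \<alpha> (D (hopf_map \<beta> v)))) (at z)"
  proof (rule bounded_linear.has_derivative[OF bounded_linear_hopf_map])
    show "((\<lambda>z. h (hopf_map \<beta> z)) has_derivative (\<lambda>v. D (hopf_map \<beta> v))) (at z)"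
      using diff_chain_at[OF bounded_linear_imp_has_derivative[OF bounded_linear_hopf_map] D(1)]
      by (simp add: o_def)
  qed
  then show "\<exists>D. ((\<lambda>z. hopf_map \<alpha> (h (hopf_map \<beta> z))) has_derivative D) (at z) \<and> (\<forall>c v. D (c *s v) = c *s D v)"
    using D(2) by (auto simp: hopf_map_scale)
qed

lemma holomorphic_map_on_cong:
  assumes "holomorphic_map_on h U" "open U" "\<And>z. z \<in> U \<Longrightarrow> h z = g z"
  shows "holomorphic_map_on g U"
  unfolding holomorphic_map_on_def
proof
  fix z assume z: "z \<in> U"
  then obtain D where "(h has_derivative D) (at z)" "\<forall>c v. D (c *s v) = c *s D v"
    using assms(1) by (auto simp: holomorphic_map_on_def)
  then show "\<exists>D. (g has_derivative D) (at z) \<and> (\<forall>c v. D (c *s v) = c *s D v)"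
    using has_derivative_transform_within_open[of h D z UNIV U g] assms(2,3) z by auto
qed

text \<open>
  The morphism near a point, expressed on an open subset of the covering space rather than of the
  quotient; in this form it can be moved along orbits.
\<close>

definition local_column ::
  "complex ^ 'n \<Rightarrow> complex \<Rightarrow>
     (((complex ^ 'n) \<times> complex) set \<Rightarrow> ((complex ^ 'n) \<times> (complex ^ 'n)) set) \<Rightarrow>
     (complex ^ 'n) set \<Rightarrow> (complex ^ 'n \<Rightarrow> complex ^ 'n) \<Rightarrow> bool" where
  "local_column \<mu> b \<Phi> U h \<longleftrightarrow> open U \<and> U \<subseteq> punctured \<and> holomorphic_map_on h U \<and>
     (\<forall>z\<in>U. \<forall>v. \<Phi> (line_pt \<mu> b z v) = cotangent_pt \<mu> z (v *s h z))"

text \<open>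
  One lemma for both directions along an orbit: \<^term>\<open>\<alpha>\<close> and
  \<^term>\<open>\<beta>\<close> stand for the multipliers and their inverses in either order. The form near
  \<^term>\<open>hopf_map \<alpha> z\<close> is pulled back from the one near \<^term>\<open>z\<close> by
  \<^term>\<open>hopf_map \<beta>\<close>.
\<close>

lemma local_column_transport:
  assumes col: "local_column \<mu> b \<Phi> U h"
    and inverse: "\<And>z. hopf_map \<beta> (hopf_map \<alpha> z) = z"
    and nonzero: "\<And>i. \<beta> $ i \<noteq> 0"
    and line: "\<And>z v. z \<in> punctured \<Longrightarrow> line_pt \<mu> b z v = line_pt \<mu> b (hopf_map \<beta> z) (c * v)"
    and cotangent: "\<And>z \<xi>. z \<in> punctured \<Longrightarrow>
       cotangent_pt \<mu> (hopf_map \<beta> z) \<xi> = cotangent_pt \<mu> z (hopf_map \<beta> \<xi>)"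
    and "z \<in> U"
  shows "\<exists>V g. hopf_map \<alpha> z \<in> V \<and> local_column \<mu> b \<Phi> V g"
proof (intro exI conjI)
  let ?V = "hopf_map \<beta> -` U"
  let ?g = "\<lambda>z. hopf_map (\<chi> i. c * \<beta> $ i) (h (hopf_map \<beta> z))"
  show "hopf_map \<alpha> z \<in> ?V"
    using inverse \<open>z \<in> U\<close> by simp
  have "?V \<subseteq> punctured"
  proof
    fix z assume "z \<in> ?V"
    then have "hopf_map \<beta> z \<noteq> 0"
      using col by (auto simp: local_column_def punctured_def)
    moreover have "hopf_map \<beta> 0 = 0"
      by (simp add: vec_eq_iff)
    ultimately show "z \<in> punctured"
      by (auto simp: punctured_def)
  qed
  moreover have "open ?V"
    using col by (intro open_vimage continuous_at_imp_continuous_on)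
      (auto simp: local_column_def intro!: linear_continuous_at bounded_linear_hopf_map)
  moreover have "holomorphic_map_on ?g ?V"
    using col by (intro holomorphic_map_on_diagonal_conjugate) (simp add: local_column_def)
  moreover have "\<Phi> (line_pt \<mu> b z v) = cotangent_pt \<mu> z (v *s ?g z)" if "z \<in> ?V" for z v
  proof -
    have "z \<in> punctured" using that \<open>?V \<subseteq> punctured\<close> by auto
    then have "\<Phi> (line_pt \<mu> b z v) = cotangent_pt \<mu> (hopf_map \<beta> z) ((c * v) *s h (hopf_map \<beta> z))"
      using that col by (simp add: line local_column_def)
    also have "\<dots> = cotangent_pt \<mu> z (v *s ?g z)"
      using \<open>z \<in> punctured\<close>
      by (subst cotangent) (auto intro!: arg_cong[of _ _ "cotangent_pt \<mu> z"] simp: vec_eq_iff mult_ac)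
    finally show ?thesis .
  qed
  ultimately show "local_column \<mu> b \<Phi> ?V ?g"
    by (simp add: local_column_def)
qed

text \<open>
  A chart of the Hopf manifold contains some point of each orbit, not a prescribed one; moving it
  by powers of the generator gives a column near every point of the covering space.
\<close>

lemma local_column_exists:
  fixes \<mu> :: "complex ^ 'n"
  assumes mult: "hopf_multipliers \<mu>" and "b \<noteq> 0"
    and mor: "line_to_cotangent_morphism \<mu> b \<Phi>" and z: "z \<in> punctured"
  shows "\<exists>U h. z \<in> U \<and> local_column \<mu> b \<Phi> U h"
proof -
  let ?P = "\<lambda>z. \<exists>U h. z \<in> U \<and> local_column \<mu> b \<Phi> U h"
  let ?\<nu> = "\<chi> i. inverse (\<mu> $ i)"
  note nonzero = hopf_multipliers_nonzero[OF mult]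
  note inverse = hopf_map_inverse[OF nonzero]
  have cotangent: "cotangent_pt \<mu> (hopf_map \<mu> w) (hopf_map ?\<nu> \<xi>) = cotangent_pt \<mu> w \<xi>"
    if "w \<in> punctured" for w \<xi>
    using cotangent_pt_step[OF mult that, of \<xi>] by (simp add: hopf_map_def)
  have forward: "?P (hopf_map \<mu> w)" if "?P w" for w
  proof -
    from that obtain U h where U: "w \<in> U" "local_column \<mu> b \<Phi> U h" by auto
    show ?thesis
    proof (rule local_column_transport[where c = "inverse b" and \<beta> = ?\<nu>, OF U(2) inverse(2) _ _ _ U(1)])
      fix z :: "complex ^ 'n" and v \<xi> assume "z \<in> punctured"
      then have "hopf_map ?\<nu> z \<in> punctured"
        using nonzero by (intro hopf_map_in_punctured) auto
      then show "line_pt \<mu> b z v = line_pt \<mu> b (hopf_map ?\<nu> z) (inverse b * v)"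
        and "cotangent_pt \<mu> (hopf_map ?\<nu> z) \<xi> = cotangent_pt \<mu> z (hopf_map ?\<nu> \<xi>)"
        using line_pt_step[OF mult \<open>b \<noteq> 0\<close>, of "hopf_map ?\<nu> z" "inverse b * v"]
          cotangent[of "hopf_map ?\<nu> z" \<xi>] \<open>b \<noteq> 0\<close>
        by (simp_all add: inverse flip: mult.assoc)
    qed (use nonzero in auto)
  qed
  have backward: "?P w" if "?P (hopf_map \<mu> w)" for w
  proof -
    from that obtain U h where U: "hopf_map \<mu> w \<in> U" "local_column \<mu> b \<Phi> U h" by auto
    have "?P (hopf_map ?\<nu> (hopf_map \<mu> w))"
    proof (rule local_column_transport[where c = b and \<beta> = \<mu>, OF U(2) inverse(1) nonzero _ _ U(1)])
      fix z :: "complex ^ 'n" and v \<xi> assume z: "z \<in> punctured"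
      show "line_pt \<mu> b z v = line_pt \<mu> b (hopf_map \<mu> z) (b * v)"
        using line_pt_step[OF mult \<open>b \<noteq> 0\<close> z] by simp
      show "cotangent_pt \<mu> (hopf_map \<mu> z) \<xi> = cotangent_pt \<mu> z (hopf_map \<mu> \<xi>)"
        using cotangent[OF z, of "hopf_map \<mu> \<xi>"] by (simp add: inverse)
    qed
    then show ?thesis by (simp add: inverse)
  qed
  have "hopf_pt \<mu> z \<in> hopf_manifold \<mu>"
    using z by (auto simp: hopf_pt_def hopf_manifold_def intro: quotientI)
  then obtain U h u where "open U" "U \<subseteq> punctured" "holomorphic_map_on h U"
      "\<forall>z\<in>U. \<forall>v. \<Phi> (line_pt \<mu> b z v) = cotangent_pt \<mu> z (v *s h z)"
    and u: "u \<in> U" "hopf_pt \<mu> z = hopf_pt \<mu> u"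
    using mor by (force simp: line_to_cotangent_morphism_def chart_around_def)
  then have "?P u" and "u \<in> punctured"
    by (auto simp: local_column_def)
  from u(2) obtain k where "u = (hopf_map \<mu> ^^ k) z \<or> z = (hopf_map \<mu> ^^ k) u"
    using orbit_class_eq_iff[OF inj_hopf_map[OF nonzero] z \<open>u \<in> punctured\<close>] by (auto simp: hopf_pt_def)
  moreover have "?P ((hopf_map \<mu> ^^ k) w)" if "?P w" for k w
    using that
  proof (induction k)
    case (Suc k)
    then show ?case
      using forward[of "(hopf_map \<mu> ^^ k) w"] by simp
  qed simp
  moreover have "?P w" if "?P ((hopf_map \<mu> ^^ k) w)" for k w
    using that
  proof (induction k)
    case (Suc k)
    then show ?case
      using backward[of "(hopf_map \<mu> ^^ k) w"] by simp
  qed simp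
  ultimately show ?thesis
    using \<open>?P u\<close> by blast
qed

text \<open>
  The value at a point \<^term>\<open>z\<close> of the induced form is read off from the image of the class of
  \<^term>\<open>(z, 1)\<close>. It agrees with each local column where that is defined, hence it is holomorphic.
\<close>

lemma inducing_form_exists:
  fixes \<mu> :: "complex ^ 'n"
  assumes mult: "hopf_multipliers \<mu>" and "b \<noteq> 0" and dist: "distribution_given_by \<mu> b \<Phi> F"
  shows "\<exists>\<omega>. induced_by \<mu> b F \<omega>"
proof -
  have mor: "line_to_cotangent_morphism \<mu> b \<Phi>" and inj: "inj_on \<Phi> (line_bundle \<mu> b)"
    and F: "F = {tangent_pt \<mu> z v | z v. z \<in> punctured \<and>
            (\<exists>\<xi>. \<Phi> (line_pt \<mu> b z 1) = cotangent_pt \<mu> z \<xi> \<and> covector_apply \<xi> v = 0)}"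
    using dist by (auto simp: distribution_given_by_def line_to_cotangent_embedding_def)
  define \<omega> where "\<omega> z = (THE \<xi>. \<Phi> (line_pt \<mu> b z 1) = cotangent_pt \<mu> z \<xi>)" for z
  have \<omega>_eq: "\<omega> z = \<xi>" if "z \<in> punctured" "\<Phi> (line_pt \<mu> b z 1) = cotangent_pt \<mu> z \<xi>" for z \<xi>
    using that by (auto simp: \<omega>_def cotangent_pt_inject[OF mult])
  have column: "\<exists>U h. z \<in> U \<and> local_column \<mu> b \<Phi> U h \<and> (\<forall>w\<in>U. \<omega> w = h w)"
    if z: "z \<in> punctured" for z
  proof -
    obtain U h where Uh: "z \<in> U" "local_column \<mu> b \<Phi> U h"
      using local_column_exists[OF mult \<open>b \<noteq> 0\<close> mor z] by auto
    moreover have "\<omega> w = h w" if "w \<in> U" for w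
    proof (rule \<omega>_eq)
      show "\<Phi> (line_pt \<mu> b w 1) = cotangent_pt \<mu> w (h w)"
        using Uh(2) that unfolding local_column_def by (metis vector_smult_lid)
    qed (use Uh that in \<open>auto simp: local_column_def\<close>)
    ultimately show ?thesis by blast
  qed
  have section_\<omega>: "\<Phi> (line_pt \<mu> b z v) = cotangent_pt \<mu> z (v *s \<omega> z)" if "z \<in> punctured" for z v
    using column[OF that] by (auto simp: local_column_def)
  have "holomorphic_map_on \<omega> punctured"
    unfolding holomorphic_map_on_def
  proof
    fix z :: "complex ^ 'n" assume "z \<in> punctured"
    then obtain U h where "z \<in> U" "local_column \<mu> b \<Phi> U h" "\<forall>w\<in>U. \<omega> w = h w"
      using column by blast
    then have "holomorphic_map_on \<omega> U"
      by (auto simp: local_column_def intro: holomorphic_map_on_cong)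
    with \<open>z \<in> U\<close> show "\<exists>D. (\<omega> has_derivative D) (at z) \<and> (\<forall>c v. D (c *s v) = c *s D v)"
      by (auto simp: holomorphic_map_on_def)
  qed
  moreover have "\<omega> z \<noteq> 0" if z: "z \<in> punctured" for z
  proof
    assume "\<omega> z = 0"
    then have "\<Phi> (line_pt \<mu> b z 0) = \<Phi> (line_pt \<mu> b z 1)"
      by (simp add: section_\<omega>[OF z])
    then have "line_pt \<mu> b z 0 = line_pt \<mu> b z 1"
      using inj line_pt_in_line_bundle[OF z] by (auto dest: inj_onD)
    then show False
      by (simp add: line_pt_inject[OF mult \<open>b \<noteq> 0\<close> z])
  qed
  moreover have "\<omega> (hopf_map \<mu> z) $ k = inverse (\<mu> $ k) * inverse b * \<omega> z $ k"
    if z: "z \<in> punctured" for z k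
  proof -
    have "\<Phi> (line_pt \<mu> b (hopf_map \<mu> z) 1) = \<Phi> (line_pt \<mu> b z (inverse b))"
      using line_pt_step[OF mult \<open>b \<noteq> 0\<close> z, of "inverse b"] \<open>b \<noteq> 0\<close> by simp
    also have "\<dots> = cotangent_pt \<mu> z (inverse b *s \<omega> z)"
      by (rule section_\<omega>[OF z])
    also have "\<dots> = cotangent_pt \<mu> (hopf_map \<mu> z) (\<chi> k. inverse (\<mu> $ k) * (inverse b *s \<omega> z) $ k)"
      by (rule cotangent_pt_step[OF mult z, symmetric])
    finally show ?thesis
      using \<omega>_eq hopf_map_in_punctured[OF hopf_multipliers_nonzero[OF mult] z] by simp
  qed
  moreover have "F = {tangent_pt \<mu> z v | z v. z \<in> punctured \<and> covector_apply (\<omega> z) v = 0}"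
  proof -
    have "(\<exists>\<xi>. \<Phi> (line_pt \<mu> b z 1) = cotangent_pt \<mu> z \<xi> \<and> covector_apply \<xi> v = 0)
        \<longleftrightarrow> covector_apply (\<omega> z) v = 0" if "z \<in> punctured" for z v
      using section_\<omega>[OF that, of 1] \<omega>_eq[OF that] by auto
    then show ?thesis unfolding F by blast
  qed
  ultimately show ?thesis
    unfolding induced_by_def by blast
qed

section \<open>Polynomial growth and polynomial coordinate lines\<close>

definition monomial :: "('n \<Rightarrow> nat) \<Rightarrow> complex ^ 'n \<Rightarrow> complex" where
  "monomial \<alpha> z = (\<Prod>i\<in>UNIV. (z $ i) ^ \<alpha> i)"

definition replace_coord :: "complex ^ 'n \<Rightarrow> 'n \<Rightarrow> complex \<Rightarrow> complex ^ 'n" where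
  "replace_coord z i w = (\<chi> l. if l = i then w else z $ l)"

lemma replace_coord_nth: "replace_coord z i w $ l = (if l = i then w else z $ l)"
  by (simp add: replace_coord_def)

lemma hopf_map_norm_bounds:
  fixes \<mu> :: "complex ^ 'n"
  assumes "hopf_multipliers \<mu>"
  obtains \<sigma> \<rho> where "0 < \<sigma>" "\<sigma> \<le> \<rho>" "\<rho> < 1"
    "\<And>z. \<sigma> * norm z \<le> norm (hopf_map \<mu> z)" "\<And>z. norm (hopf_map \<mu> z) \<le> \<rho> * norm z"
proof
  let ?N = "range (\<lambda>i. norm (\<mu> $ i))"
  define \<sigma> \<rho> where "\<sigma> = Min ?N" and "\<rho> = Max ?N"
  have bounds: "\<sigma> \<le> norm (\<mu> $ i)" "norm (\<mu> $ i) \<le> \<rho>" for i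
    by (auto simp: \<sigma>_def \<rho>_def)
  show "0 < \<sigma>" "\<rho> < 1"
    using assms by (auto simp: hopf_multipliers_def \<sigma>_def \<rho>_def)
  show "\<sigma> \<le> \<rho>"
    using bounds order.trans by blast
  then have "0 < \<rho>"
    using \<open>0 < \<sigma>\<close> by simp
  fix z :: "complex ^ 'n"
  have "norm (\<sigma> *\<^sub>R z) \<le> norm (hopf_map \<mu> z)"
    using \<open>0 < \<sigma>\<close> bounds
    by (intro norm_le_componentwise_cart) (auto simp: norm_mult intro!: mult_right_mono)
  then show "\<sigma> * norm z \<le> norm (hopf_map \<mu> z)"
    using \<open>0 < \<sigma>\<close> by simp
  have "norm (hopf_map \<mu> z) \<le> norm (\<rho> *\<^sub>R z)"
    using \<open>0 < \<rho>\<close> bounds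
    by (intro norm_le_componentwise_cart) (auto simp: norm_mult intro!: mult_right_mono)
  then show "norm (hopf_map \<mu> z) \<le> \<rho> * norm z"
    using \<open>0 < \<rho>\<close> by simp
qed

text \<open>
  Every point outside the unit ball is moved by the contraction into a compact annulus around the
  origin, after a number of steps that is logarithmic in its norm; each step changes the value by the
  fixed factor \<^term>\<open>c\<close>.
\<close>

lemma equivariant_polynomial_growth:
  fixes g :: "complex ^ 'n \<Rightarrow> complex"
  assumes mult: "hopf_multipliers \<mu>" and cont: "continuous_on punctured g" and "c \<noteq> 0"
    and equi: "\<And>z. z \<in> punctured \<Longrightarrow> g (hopf_map \<mu> z) = c * g z"
  shows "\<exists>B N. 0 \<le> B \<and> (\<forall>z. 1 \<le> norm z \<longrightarrow> norm (g z) \<le> B * norm z ^ N)"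
proof -
  obtain \<sigma> \<rho> where \<sigma>: "0 < \<sigma>" "\<sigma> \<le> \<rho>" "\<rho> < 1"
    and low: "\<And>z. \<sigma> * norm z \<le> norm (hopf_map \<mu> z)"
    and upp: "\<And>z. norm (hopf_map \<mu> z) \<le> \<rho> * norm z"
    by (rule hopf_map_norm_bounds[OF mult]) blast
  have "0 < \<rho>" using \<sigma> by simp
  \<comment> \<open>A power of \<^term>\<open>norm z\<close> decreases under the contraction faster than \<^term>\<open>g z\<close> does.\<close>
  obtain N where N: "\<rho> ^ N < norm c"
    using real_arch_pow_inv[of "norm c" \<rho>] \<sigma> \<open>c \<noteq> 0\<close> by auto
  let ?K = "cball 0 1 - ball 0 \<sigma> :: (complex ^ 'n) set"
  have "compact ?K" by (intro compact_diff) auto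
  moreover have "continuous_on ?K g"
    by (rule continuous_on_subset[OF cont]) (use \<sigma> in \<open>auto simp: punctured_def\<close>)
  ultimately have "bounded (g ` ?K)"
    by (intro compact_imp_bounded compact_continuous_image)
  then obtain M where "0 < M" and M: "\<And>z. z \<in> ?K \<Longrightarrow> norm (g z) \<le> M"
    by (force simp: bounded_pos)
  define C where "C = M / \<sigma> ^ N"
  have "0 < C" using \<sigma> \<open>0 < M\<close> by (simp add: C_def)
  have bound: "norm (g z) \<le> C * norm z ^ N" if "\<sigma> \<le> norm z" "norm z \<le> (1 / \<rho>) ^ j" for z j
    using that
  proof (induction j arbitrary: z)
    case 0
    then have "norm (g z) \<le> M" by (intro M) auto
    also have "M = C * \<sigma> ^ N" using \<sigma> by (simp add: C_def)
    also have "\<dots> \<le> C * norm z ^ N"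
      using 0 \<open>0 < C\<close> \<sigma> by (intro mult_left_mono power_mono) auto
    finally show ?case .
  next
    case (Suc j)
    show ?case
    proof (cases "norm z \<le> 1")
      case True
      then have "norm (g z) \<le> M" using Suc.prems by (intro M) auto
      also have "M = C * \<sigma> ^ N" using \<sigma> by (simp add: C_def)
      also have "\<dots> \<le> C * norm z ^ N"
        using Suc.prems \<open>0 < C\<close> \<sigma> by (intro mult_left_mono power_mono) auto
      finally show ?thesis .
    next
      case False
      have "\<sigma> \<le> norm (hopf_map \<mu> z)"
        using False low[of z] \<sigma> mult_left_mono[of 1 "norm z" \<sigma>] by linarith
      moreover have "norm (hopf_map \<mu> z) \<le> (1 / \<rho>) ^ j"
      proof -
        have "\<rho> * norm z \<le> \<rho> * (1 / \<rho>) ^ Suc j"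
          using Suc.prems \<open>0 < \<rho>\<close> by (intro mult_left_mono) auto
        then show ?thesis
          using upp[of z] \<open>0 < \<rho>\<close> by simp
      qed
      ultimately have "norm (g (hopf_map \<mu> z)) \<le> C * norm (hopf_map \<mu> z) ^ N"
        by (rule Suc.IH)
      also have "\<dots> \<le> C * (\<rho> * norm z) ^ N"
        using \<open>0 < C\<close> upp[of z] by (intro mult_left_mono power_mono) auto
      also have "\<dots> \<le> norm c * (C * norm z ^ N)"
        using N \<open>0 < C\<close> mult_right_mono[of "\<rho> ^ N" "norm c" "C * norm z ^ N"]
        by (simp add: power_mult_distrib mult_ac)
      finally have "norm c * norm (g z) \<le> norm c * (C * norm z ^ N)"
        using equi[of z] False by (cases "z = 0") (auto simp: norm_mult punctured_def)
      then show ?thesis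
        using \<open>c \<noteq> 0\<close> by simp
    qed
  qed
  have "norm (g z) \<le> C * norm z ^ N" if "1 \<le> norm z" for z
  proof -
    have "1 < 1 / \<rho>" using \<sigma> \<open>0 < \<rho>\<close> by simp
    then obtain j where "norm z < (1 / \<rho>) ^ j"
      using real_arch_pow by blast
    then show ?thesis
      using that \<sigma> by (intro bound[of _ j]) auto
  qed
  then show ?thesis
    using \<open>0 < C\<close> less_imp_le by blast
qed

lemma holomorphic_map_on_imp_continuous_on:
  assumes "holomorphic_map_on g U"
  shows "continuous_on U g"
  using assms unfolding holomorphic_map_on_def
  by (meson continuous_at_imp_continuous_on has_derivative_continuous)

text \<open>
  This brings in the theory of one complex variable: on the punctured space, a coordinate line that
  avoids the origin carries an entire function.
\<close>

lemma holomorphic_on_coordinate_line: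
  fixes g :: "complex ^ 'n \<Rightarrow> complex ^ 'm"
  assumes hol: "holomorphic_map_on g U" and line: "\<And>w. replace_coord z i w \<in> U"
  shows "(\<lambda>w. g (replace_coord z i w) $ k) holomorphic_on UNIV"
proof (rule holomorphic_onI, rule field_differentiable_at_within)
  fix w
  obtain D where D: "(g has_derivative D) (at (replace_coord z i w))" "\<And>c v. D (c *s v) = c *s D v"
    using hol line[of w] unfolding holomorphic_map_on_def by blast
  have "bounded_linear (\<lambda>v :: complex. v *s axis i 1 :: complex ^ 'n)"
    by (auto intro!: linear_conv_bounded_linear[THEN iffD1] linearI simp: vec_eq_iff algebra_simps)
  then have "((\<lambda>w. replace_coord z i 0 + w *s axis i 1) has_derivative (\<lambda>v. 0 + v *s axis i 1)) (at w)"
    by (intro has_derivative_add has_derivative_const bounded_linear_imp_has_derivative)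
  moreover have "replace_coord z i = (\<lambda>w. replace_coord z i 0 + w *s axis i 1)"
    by (auto simp: fun_eq_iff vec_eq_iff replace_coord_def axis_def)
  ultimately have "(replace_coord z i has_derivative (\<lambda>v. v *s axis i 1)) (at w)"
    by simp
  from diff_chain_at[OF this D(1)]
  have "((\<lambda>w. g (replace_coord z i w) $ k) has_derivative (\<lambda>v. D (v *s axis i 1) $ k)) (at w)"
    by (intro bounded_linear.has_derivative[OF bounded_linear_vec_nth]) (simp add: o_def)
  moreover have "(\<lambda>v. D (v *s axis i 1) $ k) = (*) (D (axis i 1) $ k)"
    by (simp add: D(2) fun_eq_iff)
  ultimately show "(\<lambda>w. g (replace_coord z i w) $ k) field_differentiable at w"
    by (auto simp: field_differentiable_def has_field_derivative_def)
qed

lemma norm_replace_coord: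
  shows "norm w \<le> norm (replace_coord z i w)"
    and "norm (replace_coord z i w) \<le> norm (replace_coord z i 0) + norm w"
proof -
  show "norm w \<le> norm (replace_coord z i w)"
    using Finite_Cartesian_Product.norm_nth_le[of "replace_coord z i w" i] by (simp add: replace_coord_nth)
  have "replace_coord z i w = replace_coord z i 0 + axis i w"
    by (simp add: vec_eq_iff replace_coord_def axis_def)
  moreover have "norm (axis i w) \<le> norm w"
  proof -
    have "norm (axis i w) \<le> (\<Sum>j\<in>UNIV. norm (axis i w $ j))"
      unfolding norm_vec_def by (rule L2_set_le_sum) simp
    also have "\<dots> = (\<Sum>j\<in>UNIV. if j = i then norm w else 0)"
      by (intro sum.cong) (auto simp: axis_def)
    finally show ?thesis by simp
  qed
  ultimately show "norm (replace_coord z i w) \<le> norm (replace_coord z i 0) + norm w"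
    using norm_triangle_ineq[of "replace_coord z i 0" "axis i w"] by simp
qed

text \<open>
  By Liouville's theorem, polynomial growth makes the restriction to every coordinate line that avoids
  the origin a polynomial. This replaces the extension of the components across the origin by
  Hartogs' theorem.
\<close>

lemma equivariant_coordinate_line_polynomial:
  fixes g :: "complex ^ 'n \<Rightarrow> complex ^ 'm"
  assumes mult: "hopf_multipliers \<mu>" and hol: "holomorphic_map_on g punctured" and "c \<noteq> 0"
    and equi: "\<And>z. z \<in> punctured \<Longrightarrow> g (hopf_map \<mu> z) $ k = c * g z $ k"
  obtains N where "\<And>z i. \<exists>l. l \<noteq> i \<and> z $ l \<noteq> 0 \<Longrightarrow>
    \<exists>p. degree p \<le> N \<and> (\<forall>w. g (replace_coord z i w) $ k = poly p w)"
proof -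
  have "continuous_on punctured (\<lambda>z. g z $ k)"
    by (intro continuous_intros holomorphic_map_on_imp_continuous_on[OF hol])
  then obtain B N where "0 \<le> B" and B: "\<And>z. 1 \<le> norm z \<Longrightarrow> norm (g z $ k) \<le> B * norm z ^ N"
    using equivariant_polynomial_growth[where g = "\<lambda>z. g z $ k", OF mult _ \<open>c \<noteq> 0\<close> equi] by blast
  show thesis
  proof (rule that[of N])
    fix z :: "complex ^ 'n" and i
    assume "\<exists>l. l \<noteq> i \<and> z $ l \<noteq> 0"
    then have line: "replace_coord z i w \<in> punctured" for w
      by (auto simp: punctured_def vec_eq_iff replace_coord_nth)
    let ?h = "\<lambda>w. g (replace_coord z i w) $ k"
    define R where "R = norm (replace_coord z i 0)"
    have "norm (?h w) \<le> (B * (R + 1) ^ N) * norm w ^ N" if "1 \<le> norm w" for w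
    proof -
      have "norm (?h w) \<le> B * norm (replace_coord z i w) ^ N"
        using norm_replace_coord(1)[of w z i] that by (intro B) simp
      also have "\<dots> \<le> B * ((R + 1) * norm w) ^ N"
      proof (intro mult_left_mono power_mono)
        have "R \<le> R * norm w"
          using mult_left_mono[OF that, of R] by (simp add: R_def)
        then show "norm (replace_coord z i w) \<le> (R + 1) * norm w"
          using norm_replace_coord(2)[of z i w] by (simp add: R_def algebra_simps)
      qed (use \<open>0 \<le> B\<close> in auto)
      finally show ?thesis
        by (simp add: power_mult_distrib mult_ac)
    qed
    then have expand: "?h w = (\<Sum>j\<le>N. (deriv ^^ j) ?h 0 / fact j * w ^ j)" for w
      by (rule Liouville_polynomial[OF holomorphic_on_coordinate_line[OF hol line]])
    let ?p = "\<Sum>j\<le>N. monom ((deriv ^^ j) ?h 0 / fact j) j"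
    have "degree ?p \<le> N"
      by (intro degree_sum_le) (auto intro: order.trans[OF degree_monom_le])
    moreover have "?h w = poly ?p w" for w
      by (simp only: poly_sum poly_monom) (rule expand)
    ultimately show "\<exists>p. degree p \<le> N \<and> (\<forall>w. ?h w = poly p w)"
      by blast
  qed
qed

section \<open>Interpolation in all variables\<close>

definition lagrange_basis :: "'a :: field set \<Rightarrow> 'a \<Rightarrow> 'a poly" where
  "lagrange_basis A x = (\<Prod>y\<in>A - {x}. smult (inverse (x - y)) [:- y, 1:])"

lemma degree_lagrange_basis:
  assumes "finite A" "x \<in> A"
  shows "degree (lagrange_basis A x) < card A"
proof -
  have linear: "degree (smult c [:- y, 1:]) \<le> 1" for c y :: 'a
    by (rule order.trans[OF degree_smult_le]) simp
  have "degree (lagrange_basis A x) \<le> (\<Sum>y\<in>A - {x}. 1)"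
    unfolding lagrange_basis_def
  proof (rule order.trans[OF degree_prod_sum_le])
    show "sum (degree \<circ> (\<lambda>y. smult (inverse (x - y)) [:- y, 1:])) (A - {x}) \<le> (\<Sum>y\<in>A - {x}. 1)"
      unfolding o_def by (intro sum_mono linear)
  qed (use assms in simp)
  also have "\<dots> < card A"
    using assms card_gt_0_iff[of A] by auto
  finally show ?thesis .
qed

lemma poly_lagrange_basis:
  assumes "finite A" "x \<in> A" "y \<in> A"
  shows "poly (lagrange_basis A x) y = (if x = y then 1 else 0)"
proof (cases "x = y")
  case True
  have "poly (smult (inverse (x - u)) [:- u, 1:]) x = 1" if "u \<in> A - {x}" for u
  proof -
    have "poly (smult (inverse (x - u)) [:- u, 1:]) x = inverse (x - u) * (x - u)"
      by (simp add: algebra_simps)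
    also have "\<dots> = 1"
      using that by (intro left_inverse) auto
    finally show ?thesis .
  qed
  then show ?thesis
    using True by (simp add: lagrange_basis_def poly_prod del: poly_smult)
next
  case False
  then have "(\<Prod>u\<in>A - {x}. poly (smult (inverse (x - u)) [:- u, 1:]) y) = 0"
    using assms by (intro prod_zero bexI[of _ y]) auto
  then show ?thesis
    using False by (simp add: lagrange_basis_def poly_prod)
qed

lemma lagrange_interpolation:
  assumes "finite A" "degree p < card A"
  shows "poly p w = (\<Sum>x\<in>A. poly p x * poly (lagrange_basis A x) w)"
proof -
  let ?q = "\<Sum>x\<in>A. smult (poly p x) (lagrange_basis A x)"
  have "p = ?q"
  proof (rule poly_eqI_degree)
    show "poly p x = poly ?q x" if "x \<in> A" for x
    proof -
      have "poly ?q x = (\<Sum>y\<in>A. if y = x then poly p y else 0)"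
        unfolding poly_sum by (rule sum.cong) (use that assms(1) in \<open>auto simp: poly_lagrange_basis\<close>)
      then show ?thesis
        using that assms(1) by simp
    qed
    have "degree ?q \<le> card A - 1"
    proof (rule degree_sum_le[OF assms(1)])
      fix x assume "x \<in> A"
      then show "degree (smult (poly p x) (lagrange_basis A x)) \<le> card A - 1"
        using degree_lagrange_basis[OF assms(1)] degree_smult_le[of "poly p x" "lagrange_basis A x"]
        by fastforce
    qed
    then show "degree ?q < card A"
      using assms(2) by linarith
  qed (fact assms(2))
  then have "poly p w = poly ?q w" by simp
  then show ?thesis by (simp add: poly_sum)
qed

lemma sum_PiE_insert:
  assumes "i \<notin> S"
  shows "(\<Sum>x\<in>PiE (insert i S) A. F x) = (\<Sum>x\<in>PiE S A. \<Sum>y\<in>A i. F (x(i := y)))"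
proof -
  have "(\<Sum>x\<in>PiE (insert i S) A. F x) = (\<Sum>(y, x)\<in>A i \<times> PiE S A. F (x(i := y)))"
    unfolding PiE_insert_eq
    by (subst sum.reindex[OF inj_combinator[OF assms]]) (simp add: case_prod_unfold o_def)
  also have "\<dots> = (\<Sum>y\<in>A i. \<Sum>x\<in>PiE S A. F (x(i := y)))"
    by (simp add: sum.cartesian_product)
  finally show ?thesis
    by (simp add: sum.swap[of _ "A i"])
qed

text \<open>
  Lagrange interpolation is applied in one variable after the other, which involves one coordinate
  line at a time.

  Only lines that avoid the origin are available. A point other than the origin has a coordinate
  \<^term>\<open>z $ l \<noteq> 0\<close>, so the first interpolation can be done in any variable
  \<^term>\<open>i\<^sub>0\<close> different from \<^term>\<open>l\<close>. From then on the coordinate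
  \<^term>\<open>i\<^sub>0\<close> is an interpolation node, and since \<^term>\<open>0 :: complex\<close> is not a
  node, it keeps all further lines away from the origin.
\<close>

lemma tensor_interpolation:
  fixes g :: "complex ^ 'n \<Rightarrow> complex"
  assumes A: "finite A" "0 \<notin> A" and "CARD('n) \<ge> 2"
    and line: "\<And>z i. \<exists>l. l \<noteq> i \<and> z $ l \<noteq> 0 \<Longrightarrow>
      \<exists>p. degree p < card A \<and> (\<forall>w. g (replace_coord z i w) = poly p w)"
    and z: "z \<in> punctured"
  shows "g z = (\<Sum>x\<in>UNIV \<rightarrow>\<^sub>E A. g (\<chi> i. x i) * (\<Prod>i\<in>UNIV. poly (lagrange_basis A (x i)) (z $ i)))"
proof -
  have step: "g u = (\<Sum>y\<in>A. g (replace_coord u i y) * poly (lagrange_basis A y) (u $ i))"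
    if other: "l \<noteq> i" "u $ l \<noteq> 0" for u i l
  proof -
    obtain p where p: "degree p < card A" "\<And>w. g (replace_coord u i w) = poly p w"
      using line[of i u] other by blast
    have "replace_coord u i (u $ i) = u"
      by (simp add: vec_eq_iff replace_coord_nth)
    then have "g u = poly p (u $ i)"
      using p(2)[of "u $ i"] by simp
    then show ?thesis
      unfolding p(2) by (simp only: lagrange_interpolation[OF A(1) p(1), of "u $ i"])
  qed
  \<comment> \<open>The coordinates in \<^term>\<open>S\<close> have already been replaced by nodes.\<close>
  define mix where "mix S x = (\<chi> l. if l \<in> S then x l else z $ l)" for S and x :: "'n \<Rightarrow> complex"
  obtain l where l: "z $ l \<noteq> 0"
    using z by (auto simp: punctured_def vec_eq_iff)
  have "card (UNIV - {l}) \<noteq> 0"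
    using \<open>CARD('n) \<ge> 2\<close> by (simp add: card_Diff_singleton)
  then have "UNIV - {l} \<noteq> {}" by force
  then obtain i\<^sub>0 where i\<^sub>0: "i\<^sub>0 \<noteq> l" by blast
  have extend: "(\<Sum>x\<in>S \<rightarrow>\<^sub>E A. g (mix S x) * (\<Prod>i\<in>S. poly (lagrange_basis A (x i)) (z $ i)))
      = (\<Sum>x\<in>insert i S \<rightarrow>\<^sub>E A. g (mix (insert i S) x) * (\<Prod>i\<in>insert i S. poly (lagrange_basis A (x i)) (z $ i)))"
    if "i \<notin> S" and other: "\<And>x. x \<in> S \<rightarrow>\<^sub>E A \<Longrightarrow> \<exists>l. l \<noteq> i \<and> mix S x $ l \<noteq> 0" for i S
  proof (subst sum_PiE_insert[OF \<open>i \<notin> S\<close>], rule sum.cong[OF refl])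
    fix x assume "x \<in> S \<rightarrow>\<^sub>E A"
    then have "g (mix S x) = (\<Sum>y\<in>A. g (replace_coord (mix S x) i y) * poly (lagrange_basis A y) (mix S x $ i))"
      using other step by blast
    also have "\<dots> = (\<Sum>y\<in>A. g (mix (insert i S) (x(i := y))) * poly (lagrange_basis A y) (z $ i))"
    proof -
      have "replace_coord (mix S x) i y = mix (insert i S) (x(i := y))" for y
        by (simp add: vec_eq_iff replace_coord_nth mix_def)
      then show ?thesis
        using \<open>i \<notin> S\<close> by (simp add: mix_def)
    qed
    finally have "g (mix S x) = (\<Sum>y\<in>A. g (mix (insert i S) (x(i := y))) * poly (lagrange_basis A y) (z $ i))" .
    moreover have "(\<Prod>l\<in>insert i S. poly (lagrange_basis A ((x(i := y)) l)) (z $ l))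
        = poly (lagrange_basis A y) (z $ i) * (\<Prod>l\<in>S. poly (lagrange_basis A (x l)) (z $ l))" for y
    proof -
      have "(\<Prod>l\<in>S. poly (lagrange_basis A ((x(i := y)) l)) (z $ l)) = (\<Prod>l\<in>S. poly (lagrange_basis A (x l)) (z $ l))"
        using \<open>i \<notin> S\<close> by (intro prod.cong) auto
      then show ?thesis
        using \<open>i \<notin> S\<close> by simp
    qed
    ultimately show "g (mix S x) * (\<Prod>l\<in>S. poly (lagrange_basis A (x l)) (z $ l)) =
        (\<Sum>y\<in>A. g (mix (insert i S) (x(i := y))) *
          (\<Prod>l\<in>insert i S. poly (lagrange_basis A ((x(i := y)) l)) (z $ l)))"
      by (simp add: sum_distrib_right mult.assoc)
  qed
  have "g z = (\<Sum>x\<in>insert i\<^sub>0 T \<rightarrow>\<^sub>E A. g (mix (insert i\<^sub>0 T) x) *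
      (\<Prod>i\<in>insert i\<^sub>0 T. poly (lagrange_basis A (x i)) (z $ i)))" if "i\<^sub>0 \<notin> T" for T
    using finite[of T] that
  proof (induction T rule: finite_induct)
    case empty
    have "mix {} x = z" for x
      by (simp add: mix_def vec_eq_iff)
    then show ?case
      using extend[of i\<^sub>0 "{}"] l i\<^sub>0[symmetric] by fastforce
  next
    case (insert i T)
    have "\<exists>l. l \<noteq> i \<and> mix (insert i\<^sub>0 T) x $ l \<noteq> 0" if "x \<in> insert i\<^sub>0 T \<rightarrow>\<^sub>E A" for x
    proof (intro exI conjI)
      show "i\<^sub>0 \<noteq> i" using insert.prems by auto
      have "x i\<^sub>0 \<in> A" using that by auto
      then show "mix (insert i\<^sub>0 T) x $ i\<^sub>0 \<noteq> 0"
        using A(2) by (auto simp: mix_def)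
    qed
    then show ?case
      using extend[of i "insert i\<^sub>0 T"] insert by (auto simp: insert_commute)
  qed
  from this[of "UNIV - {i\<^sub>0}"] show ?thesis
    by (simp add: insert_UNIV mix_def)
qed

section \<open>Expansion into monomials of one eigenvalue\<close>

lemma prod_poly_eq_sum_monomial:
  fixes p :: "'n::finite \<Rightarrow> complex poly" and z :: "complex ^ 'n"
  assumes "\<And>i. degree (p i) < d"
  shows "(\<Prod>i\<in>UNIV. poly (p i) (z $ i))
    = (\<Sum>\<alpha>\<in>UNIV \<rightarrow>\<^sub>E {..<d}. (\<Prod>i\<in>UNIV. coeff (p i) (\<alpha> i)) * monomial \<alpha> z)"
proof -
  have "poly (p i) w = (\<Sum>k<d. coeff (p i) k * w ^ k)" for i w
    unfolding poly_altdef
    by (rule sum.mono_neutral_left) (use assms[of i] in \<open>auto simp: not_le coeff_eq_0\<close>)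
  then show ?thesis
    by (simp add: prod_sum_PiE prod.distrib monomial_def)
qed

lemma monomial_hopf_map: "monomial \<alpha> (hopf_map \<mu> z) = monomial \<alpha> \<mu> * monomial \<alpha> z"
  by (simp add: monomial_def power_mult_distrib prod.distrib)

text \<open>
  An eigenvector that is a sum of eigenvectors is the sum of those with its own eigenvalue. The
  operator enters only through its powers: the polynomial whose roots are the other eigenvalues,
  evaluated at the operator, kills the unwanted terms and multiplies the rest by a nonzero number.
\<close>

lemma eigenvector_component:
  fixes c e :: "complex" and t \<epsilon> :: "'a \<Rightarrow> complex"
  assumes "finite V" and orbit: "\<And>k. c ^ k * e = (\<Sum>\<alpha>\<in>V. \<epsilon> \<alpha> ^ k * t \<alpha>)"
  shows "e = (\<Sum>\<alpha> | \<alpha> \<in> V \<and> \<epsilon> \<alpha> = c. t \<alpha>)"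
proof -
  define p where "p = (\<Prod>\<nu>\<in>\<epsilon> ` V - {c}. [:- \<nu>, 1:])"
  have p_c: "poly p c \<noteq> 0"
    using \<open>finite V\<close> by (auto simp: p_def poly_prod prod_zero_iff)
  have p_\<epsilon>: "poly p (\<epsilon> \<alpha>) = 0" if "\<alpha> \<in> V" "\<epsilon> \<alpha> \<noteq> c" for \<alpha>
    using that \<open>finite V\<close> by (auto simp: p_def poly_prod prod_zero_iff)
  have "poly p c * e = (\<Sum>k\<le>degree p. coeff p k * (c ^ k * e))"
    by (simp add: poly_altdef sum_distrib_right mult.assoc)
  also have "\<dots> = (\<Sum>\<alpha>\<in>V. \<Sum>k\<le>degree p. coeff p k * (\<epsilon> \<alpha> ^ k * t \<alpha>))"
    by (simp add: orbit sum_distrib_left sum.swap[of _ V])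
  also have "\<dots> = (\<Sum>\<alpha>\<in>V. poly p (\<epsilon> \<alpha>) * t \<alpha>)"
    by (simp add: poly_altdef sum_distrib_right mult.assoc)
  also have "\<dots> = (\<Sum>\<alpha> | \<alpha> \<in> V \<and> \<epsilon> \<alpha> = c. poly p (\<epsilon> \<alpha>) * t \<alpha>)"
    by (rule sum.mono_neutral_right) (use \<open>finite V\<close> p_\<epsilon> in auto)
  also have "\<dots> = poly p c * (\<Sum>\<alpha> | \<alpha> \<in> V \<and> \<epsilon> \<alpha> = c. t \<alpha>)"
    by (simp add: sum_distrib_left)
  finally show ?thesis
    using p_c by simp
qed

text \<open>
  Monomials are eigenvectors of the composition with the contraction, so among the monomials in the
  polynomial found by interpolation only those with eigenvalue \<^term>\<open>c\<close> contribute. Evaluation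
  along the orbit of one point \<^term>\<open>z\<close> suffices to separate them.
\<close>

lemma equivariant_component_expansion:
  fixes g :: "complex ^ 'n \<Rightarrow> complex ^ 'm"
  assumes mult: "hopf_multipliers \<mu>" and "CARD('n) \<ge> 2"
    and hol: "holomorphic_map_on g punctured" and "c \<noteq> 0"
    and equi: "\<And>z. z \<in> punctured \<Longrightarrow> g (hopf_map \<mu> z) $ k = c * g z $ k"
  shows "\<exists>V a. finite V \<and> (\<forall>\<alpha>\<in>V. monomial \<alpha> \<mu> = c) \<and>
    (\<forall>z\<in>punctured. g z $ k = (\<Sum>\<alpha>\<in>V. a \<alpha> * monomial \<alpha> z))"
proof -
  obtain N where N: "\<And>z i. \<exists>l. l \<noteq> i \<and> z $ l \<noteq> 0 \<Longrightarrow>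
    \<exists>p. degree p \<le> N \<and> (\<forall>w. g (replace_coord z i w) $ k = poly p w)"
    using equivariant_coordinate_line_polynomial[OF mult hol \<open>c \<noteq> 0\<close> equi] by blast
  \<comment> \<open>Nonzero nodes, one more than the degree bound.\<close>
  define A where "A = (of_nat ` {1..Suc N} :: complex set)"
  have A: "finite A" "0 \<notin> A" "card A = Suc N"
  proof -
    show "finite A" "0 \<notin> A"
      unfolding A_def by (auto simp del: of_nat_Suc)
    have "inj_on (of_nat :: nat \<Rightarrow> complex) {1..Suc N}"
      by (rule inj_onI) (simp only: of_nat_eq_iff)
    then show "card A = Suc N"
      unfolding A_def by (simp only: card_image card_atLeastAtMost)
  qed
  define a where "a \<alpha> = (\<Sum>x\<in>(UNIV :: 'n set) \<rightarrow>\<^sub>E A. g (\<chi> i. x i) $ k *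
      (\<Prod>i\<in>UNIV. coeff (lagrange_basis A (x i)) (\<alpha> i)))" for \<alpha> :: "'n \<Rightarrow> nat"
  let ?W = "UNIV \<rightarrow>\<^sub>E {..<Suc N} :: ('n \<Rightarrow> nat) set"
  have "finite ?W" by (intro finite_PiE) auto
  have expand: "g z $ k = (\<Sum>\<alpha>\<in>?W. a \<alpha> * monomial \<alpha> z)" if "z \<in> punctured" for z
  proof -
    have "g z $ k = (\<Sum>x\<in>UNIV \<rightarrow>\<^sub>E A. g (\<chi> i. x i) $ k * (\<Prod>i\<in>UNIV. poly (lagrange_basis A (x i)) (z $ i)))"
    proof (rule tensor_interpolation[OF A(1,2) \<open>CARD('n) \<ge> 2\<close> _ that])
      fix z :: "complex ^ 'n" and i
      assume "\<exists>l. l \<noteq> i \<and> z $ l \<noteq> 0"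
      from N[OF this] show "\<exists>p. degree p < card A \<and> (\<forall>w. g (replace_coord z i w) $ k = poly p w)"
        by (simp only: A(3) less_Suc_eq_le)
    qed
    also have "\<dots> = (\<Sum>x\<in>UNIV \<rightarrow>\<^sub>E A. \<Sum>\<alpha>\<in>?W. g (\<chi> i. x i) $ k *
        (\<Prod>i\<in>UNIV. coeff (lagrange_basis A (x i)) (\<alpha> i)) * monomial \<alpha> z)"
    proof (rule sum.cong[OF refl])
      fix x :: "'n \<Rightarrow> complex" assume "x \<in> UNIV \<rightarrow>\<^sub>E A"
      then have "degree (lagrange_basis A (x i)) < Suc N" for i
        using degree_lagrange_basis[OF A(1), of "x i"] A(3) by (metis PiE_mem UNIV_I)
      then show "g (\<chi> i. x i) $ k * (\<Prod>i\<in>UNIV. poly (lagrange_basis A (x i)) (z $ i)) =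
          (\<Sum>\<alpha>\<in>?W. g (\<chi> i. x i) $ k * (\<Prod>i\<in>UNIV. coeff (lagrange_basis A (x i)) (\<alpha> i)) * monomial \<alpha> z)"
        by (subst prod_poly_eq_sum_monomial[of _ "Suc N"]) (auto simp: sum_distrib_left mult.assoc)
    qed
    also have "\<dots> = (\<Sum>\<alpha>\<in>?W. a \<alpha> * monomial \<alpha> z)"
      by (subst sum.swap) (simp add: a_def sum_distrib_right)
    finally show ?thesis .
  qed
  have "g z $ k = (\<Sum>\<alpha> | \<alpha> \<in> ?W \<and> monomial \<alpha> \<mu> = c. a \<alpha> * monomial \<alpha> z)" if z: "z \<in> punctured" for z
  proof (rule eigenvector_component[OF \<open>finite ?W\<close>])
    fix j
    have orbit: "(hopf_map \<mu> ^^ j) z \<in> punctured" for j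
      by (induction j) (simp_all add: z hopf_map_in_punctured[OF hopf_multipliers_nonzero[OF mult]])
    have "c ^ j * g z $ k = g ((hopf_map \<mu> ^^ j) z) $ k"
    proof (induction j)
      case (Suc j)
      then show ?case
        using equi[OF orbit[of j]] by (simp add: mult.assoc)
    qed simp
    also have "\<dots> = (\<Sum>\<alpha>\<in>?W. a \<alpha> * monomial \<alpha> ((hopf_map \<mu> ^^ j) z))"
      by (rule expand[OF orbit])
    also have "\<dots> = (\<Sum>\<alpha>\<in>?W. monomial \<alpha> \<mu> ^ j * (a \<alpha> * monomial \<alpha> z))"
    proof (rule sum.cong[OF refl])
      fix \<alpha>
      have "monomial \<alpha> ((hopf_map \<mu> ^^ j) z) = monomial \<alpha> \<mu> ^ j * monomial \<alpha> z"
        by (induction j) (auto simp: monomial_hopf_map)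
      then show "a \<alpha> * monomial \<alpha> ((hopf_map \<mu> ^^ j) z) = monomial \<alpha> \<mu> ^ j * (a \<alpha> * monomial \<alpha> z)"
        by simp
    qed
    finally show "c ^ j * g z $ k = (\<Sum>\<alpha>\<in>?W. monomial \<alpha> \<mu> ^ j * (a \<alpha> * monomial \<alpha> z))" .
  qed
  moreover have "finite {\<alpha> \<in> ?W. monomial \<alpha> \<mu> = c}"
    using \<open>finite ?W\<close> by simp
  ultimately show ?thesis
    by (intro exI[of _ "{\<alpha> \<in> ?W. monomial \<alpha> \<mu> = c}"] exI[of _ a]) auto
qed

section \<open>The monomials in a form and their resonances\<close>

lemma induced_by_cong:
  assumes mult: "hopf_multipliers \<mu>" and ind: "induced_by \<mu> b F \<omega>"
    and eq: "\<And>z. z \<in> punctured \<Longrightarrow> \<omega> z = \<eta> z"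
  shows "induced_by \<mu> b F \<eta>"
proof -
  have hol: "holomorphic_map_on \<omega> punctured"
    and nowhere: "\<And>z. z \<in> punctured \<Longrightarrow> \<omega> z \<noteq> 0"
    and equi: "\<And>z k. z \<in> punctured \<Longrightarrow>
      \<omega> (hopf_map \<mu> z) $ k = inverse (\<mu> $ k) * inverse b * \<omega> z $ k"
    and F: "F = {tangent_pt \<mu> z v | z v. z \<in> punctured \<and> covector_apply (\<omega> z) v = 0}"
    using ind unfolding induced_by_def by blast+
  have "holomorphic_map_on \<eta> punctured"
    by (rule holomorphic_map_on_cong[OF hol open_punctured eq])
  moreover have "\<eta> z \<noteq> 0" if "z \<in> punctured" for z
    using nowhere[OF that] eq[OF that] by simp
  moreover have "\<eta> (hopf_map \<mu> z) $ k = inverse (\<mu> $ k) * inverse b * \<eta> z $ k"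
    if "z \<in> punctured" for z k
    using equi[OF that] eq[OF that] eq[OF hopf_map_in_punctured[OF hopf_multipliers_nonzero[OF mult] that]]
    by simp
  moreover have "F = {tangent_pt \<mu> z v | z v. z \<in> punctured \<and> covector_apply (\<eta> z) v = 0}"
  proof -
    have "z \<in> punctured \<and> covector_apply (\<omega> z) v = 0 \<longleftrightarrow>
        z \<in> punctured \<and> covector_apply (\<eta> z) v = 0" for z v
      using eq by auto
    then show ?thesis
      unfolding F by simp
  qed
  ultimately show ?thesis
    unfolding induced_by_def by blast
qed

text \<open>
  The index set \<^term>\<open>V k\<close> collects the monomials in the coefficient of \<open>dz\<^sub>k\<close>.
  The condition on the multipliers says that each term \<open>z\<^sup>\<alpha> dz\<^sub>k\<close> is multiplied by the
  inverse of \<^term>\<open>b\<close> when it is pulled back along the contraction; only these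
  resonant terms occur.
\<close>

definition form_expansion ::
  "complex ^ 'n \<Rightarrow> complex \<Rightarrow> (complex ^ 'n \<Rightarrow> complex ^ 'n) \<Rightarrow>
     ('n \<Rightarrow> ('n \<Rightarrow> nat) set) \<Rightarrow> ('n \<Rightarrow> ('n \<Rightarrow> nat) \<Rightarrow> complex) \<Rightarrow> bool" where
  "form_expansion \<mu> b \<omega> V a \<longleftrightarrow>
     (\<forall>k. finite (V k)) \<and> (\<forall>k. \<forall>\<alpha>\<in>V k. \<mu> $ k * monomial \<alpha> \<mu> = inverse b) \<and>
     (\<forall>z\<in>punctured. \<forall>k. \<omega> z $ k = (\<Sum>\<alpha>\<in>V k. a k \<alpha> * monomial \<alpha> z))"

lemma form_expansion_exists:
  fixes \<mu> :: "complex ^ 'n"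
  assumes mult: "hopf_multipliers \<mu>" and "CARD('n) \<ge> 2" and "b \<noteq> 0"
    and ind: "induced_by \<mu> b F \<omega>"
  obtains V a where "form_expansion \<mu> b \<omega> V a"
proof -
  note nonzero = hopf_multipliers_nonzero[OF mult]
  have "\<exists>V a. finite V \<and> (\<forall>\<alpha>\<in>V. monomial \<alpha> \<mu> = inverse (\<mu> $ k) * inverse b) \<and>
      (\<forall>z\<in>punctured. \<omega> z $ k = (\<Sum>\<alpha>\<in>V. a \<alpha> * monomial \<alpha> z))" for k
  proof (rule equivariant_component_expansion[OF mult \<open>CARD('n) \<ge> 2\<close>])
    show "holomorphic_map_on \<omega> punctured"
      using ind by (simp add: induced_by_def)
    show "\<omega> (hopf_map \<mu> z) $ k = inverse (\<mu> $ k) * inverse b * \<omega> z $ k" if "z \<in> punctured" for z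
      using ind that unfolding induced_by_def by blast
    show "inverse (\<mu> $ k) * inverse b \<noteq> 0"
      using nonzero \<open>b \<noteq> 0\<close> by simp
  qed
  then obtain V a where Va: "\<And>k. finite (V k)"
      "\<And>k \<alpha>. \<alpha> \<in> V k \<Longrightarrow> monomial \<alpha> \<mu> = inverse (\<mu> $ k) * inverse b"
      "\<And>k z. z \<in> punctured \<Longrightarrow> \<omega> z $ k = (\<Sum>\<alpha>\<in>V k. a k \<alpha> * monomial \<alpha> z)"
    by metis
  then have "form_expansion \<mu> b \<omega> V a"
    using nonzero by (simp add: form_expansion_def)
  then show thesis by (rule that)
qed

lemma form_expansion_nonempty:
  fixes \<mu> :: "complex ^ 'n"
  assumes "form_expansion \<mu> b \<omega> V a" and "\<And>z. z \<in> punctured \<Longrightarrow> \<omega> z \<noteq> 0"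
  obtains k \<alpha> where "\<alpha> \<in> V k"
proof -
  have "(\<chi> i. 1) \<in> (punctured :: (complex ^ 'n) set)"
    by (simp add: punctured_def vec_eq_iff)
  with assms obtain k where "\<omega> (\<chi> i. 1) $ k \<noteq> 0"
    by (auto simp: vec_eq_iff)
  with \<open>(\<chi> i. 1) \<in> punctured\<close> assms(1) have "V k \<noteq> {}"
    by (auto simp: form_expansion_def)
  then show thesis using that by blast
qed

text \<open>
  The function \<^term>\<open>\<kappa>\<close> sends an index to the representative of its class, a class being a set
  of indices with the same multiplier. The numbers below are the multidegree of the form
  \<open>z\<^sup>\<alpha> dz\<^sub>k\<close> with respect to these classes, where \<open>dz\<^sub>k\<close> counts like the
  variable itself.
\<close>

definition class_degree :: "('n::finite \<Rightarrow> 'n) \<Rightarrow> 'n \<Rightarrow> ('n \<Rightarrow> nat) \<Rightarrow> 'n \<Rightarrow> nat" where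
  "class_degree \<kappa> k \<alpha> \<rho> = (\<Sum>i | \<kappa> i = \<rho>. \<alpha> i) + (if \<kappa> k = \<rho> then 1 else 0)"

lemma class_degree_outside: "\<rho> \<notin> range \<kappa> \<Longrightarrow> class_degree \<kappa> k \<alpha> \<rho> = 0"
  by (auto simp: class_degree_def intro: sum.neutral)

lemma sum_class_degree: "(\<Sum>\<rho>\<in>UNIV. class_degree \<kappa> k \<alpha> \<rho>) = (\<Sum>i\<in>UNIV. \<alpha> i) + 1"
  using sum.group[of UNIV UNIV \<kappa> \<alpha>] by (simp add: class_degree_def sum.distrib)

lemma multiplier_eq_prod_classes:
  fixes \<mu> :: "complex ^ 'n"
  assumes "\<And>i. \<mu> $ i = \<mu> $ \<kappa> i"
  shows "\<mu> $ k * monomial \<alpha> \<mu> = (\<Prod>\<rho>\<in>range \<kappa>. (\<mu> $ \<rho>) ^ class_degree \<kappa> k \<alpha> \<rho>)"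
proof -
  have "monomial \<alpha> \<mu> = (\<Prod>\<rho>\<in>range \<kappa>. \<Prod>i | \<kappa> i = \<rho>. (\<mu> $ i) ^ \<alpha> i)"
    using prod.image_gen[of UNIV "\<lambda>i. (\<mu> $ i) ^ \<alpha> i" \<kappa>] by (simp add: monomial_def)
  also have "\<dots> = (\<Prod>\<rho>\<in>range \<kappa>. (\<mu> $ \<rho>) ^ (\<Sum>i | \<kappa> i = \<rho>. \<alpha> i))"
    by (intro prod.cong refl, unfold power_sum, intro prod.cong refl) (metis assms mem_Collect_eq)
  finally have "monomial \<alpha> \<mu> = (\<Prod>\<rho>\<in>range \<kappa>. (\<mu> $ \<rho>) ^ (\<Sum>i | \<kappa> i = \<rho>. \<alpha> i))" .
  moreover have "(\<Prod>\<rho>\<in>range \<kappa>. (\<mu> $ \<rho>) ^ (if \<kappa> k = \<rho> then 1 else 0)) = \<mu> $ k"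
  proof -
    have "(\<Prod>\<rho>\<in>range \<kappa>. (\<mu> $ \<rho>) ^ (if \<kappa> k = \<rho> then 1 else 0)) =
        (\<Prod>\<rho>\<in>range \<kappa>. if \<kappa> k = \<rho> then \<mu> $ \<rho> else 1)"
      by (intro prod.cong) auto
    then show ?thesis
      using assms[of k] by simp
  qed
  ultimately show ?thesis
    by (simp add: class_degree_def power_add prod.distrib)
qed

text \<open>
  Cancelling the common factors of two equal monomials in the multipliers leaves a relation whose
  two sides involve disjoint sets of multipliers; these are the two sets in the proof.
\<close>

lemma no_nontrivial_relation_exponents_unique:
  fixes \<mu> :: "complex ^ 'n"
  assumes rel: "no_nontrivial_relation \<mu> R" and nonzero: "\<And>i. \<mu> $ i \<noteq> 0"
    and eq: "(\<Prod>i\<in>R. (\<mu> $ i) ^ \<gamma> i) = (\<Prod>i\<in>R. (\<mu> $ i) ^ \<delta> i)" and "\<rho> \<in> R"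
  shows "\<gamma> \<rho> = \<delta> \<rho>"
proof (rule ccontr)
  assume neq: "\<gamma> \<rho> \<noteq> \<delta> \<rho>"
  let ?A = "{i \<in> R. \<delta> i \<le> \<gamma> i}" and ?B = "{i \<in> R. \<not> \<delta> i \<le> \<gamma> i}"
  define r where "r i = (\<gamma> i - \<delta> i) + (\<delta> i - \<gamma> i)" for i
  have split: "(\<Prod>i\<in>R. h i) = (\<Prod>i\<in>?A. h i) * (\<Prod>i\<in>?B. h i)" for h :: "'n \<Rightarrow> complex"
    by (subst prod.union_disjoint[symmetric]) (auto intro!: arg_cong[of _ _ "prod h"])
  let ?m = "\<Prod>i\<in>R. (\<mu> $ i) ^ min (\<gamma> i) (\<delta> i)"
  have "(\<Prod>i\<in>R. (\<mu> $ i) ^ \<gamma> i) = ?m * (\<Prod>i\<in>?A. (\<mu> $ i) ^ r i)"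
  proof -
    have "(\<Prod>i\<in>?A. (\<mu> $ i) ^ \<gamma> i) = (\<Prod>i\<in>?A. (\<mu> $ i) ^ min (\<gamma> i) (\<delta> i)) * (\<Prod>i\<in>?A. (\<mu> $ i) ^ r i)"
      by (subst prod.distrib[symmetric]) (auto simp: r_def min_def simp flip: power_add intro!: prod.cong)
    moreover have "(\<Prod>i\<in>?B. (\<mu> $ i) ^ \<gamma> i) = (\<Prod>i\<in>?B. (\<mu> $ i) ^ min (\<gamma> i) (\<delta> i))"
      by (intro prod.cong) (auto simp: min_def)
    ultimately show ?thesis
      unfolding split[of "\<lambda>i. (\<mu> $ i) ^ \<gamma> i"] split[of "\<lambda>i. (\<mu> $ i) ^ min (\<gamma> i) (\<delta> i)"]
      by simp
  qed
  moreover have "(\<Prod>i\<in>R. (\<mu> $ i) ^ \<delta> i) = ?m * (\<Prod>i\<in>?B. (\<mu> $ i) ^ r i)"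
  proof -
    have "(\<Prod>i\<in>?B. (\<mu> $ i) ^ \<delta> i) = (\<Prod>i\<in>?B. (\<mu> $ i) ^ min (\<gamma> i) (\<delta> i)) * (\<Prod>i\<in>?B. (\<mu> $ i) ^ r i)"
      by (subst prod.distrib[symmetric]) (auto simp: r_def min_def simp flip: power_add intro!: prod.cong)
    moreover have "(\<Prod>i\<in>?A. (\<mu> $ i) ^ \<delta> i) = (\<Prod>i\<in>?A. (\<mu> $ i) ^ min (\<gamma> i) (\<delta> i))"
      by (intro prod.cong) (auto simp: min_def)
    ultimately show ?thesis
      unfolding split[of "\<lambda>i. (\<mu> $ i) ^ \<delta> i"] split[of "\<lambda>i. (\<mu> $ i) ^ min (\<gamma> i) (\<delta> i)"]
      by simp
  qed
  moreover have "?m \<noteq> 0"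
    using nonzero by (simp add: prod_zero_iff)
  ultimately have "(\<Prod>i\<in>?A. (\<mu> $ i) ^ r i) = (\<Prod>i\<in>?B. (\<mu> $ i) ^ r i)"
    using eq by simp
  moreover have "r \<rho> \<noteq> 0"
    using neq by (auto simp: r_def)
  moreover have "?A \<inter> ?B = {}" "?A \<union> ?B = R"
    by auto
  ultimately show False
    using rel \<open>\<rho> \<in> R\<close> unfolding no_nontrivial_relation_def by blast
qed

text \<open>
  All resonant terms have the same product of multipliers, and the representatives of the classes are
  multiplicatively independent, so the form is homogeneous with respect to the classes.
\<close>

lemma form_expansion_class_degree:
  fixes \<mu> :: "complex ^ 'n"
  assumes nonzero: "\<And>i. \<mu> $ i \<noteq> 0" and exp: "form_expansion \<mu> b \<omega> V a"
    and classes: "\<And>i. \<mu> $ i = \<mu> $ \<kappa> i" and rel: "no_nontrivial_relation \<mu> (range \<kappa>)"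
  obtains \<gamma> where "\<And>k \<alpha> \<rho>. \<alpha> \<in> V k \<Longrightarrow> class_degree \<kappa> k \<alpha> \<rho> = \<gamma> \<rho>"
proof -
  have "class_degree \<kappa> k \<alpha> \<rho> = class_degree \<kappa> l \<beta> \<rho>" if "\<alpha> \<in> V k" "\<beta> \<in> V l" for k l \<alpha> \<beta> \<rho>
  proof (cases "\<rho> \<in> range \<kappa>")
    case True
    have "\<mu> $ k * monomial \<alpha> \<mu> = \<mu> $ l * monomial \<beta> \<mu>"
      using that exp by (simp add: form_expansion_def)
    then show ?thesis
      unfolding multiplier_eq_prod_classes[OF classes]
      by (rule no_nontrivial_relation_exponents_unique[OF rel nonzero _ True])
  qed (simp add: class_degree_outside)
  then show thesis
    using that by metis
qed

section \<open>Common zeros of forms of higher degree\<close>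

lemma monomial_eq_0:
  assumes "\<alpha> i \<noteq> 0" "z $ i = 0"
  shows "monomial \<alpha> z = 0"
  using assms by (auto simp: monomial_def prod_zero_iff power_0_left intro!: bexI[of _ i])

text \<open>
  If a term has total degree at least two in the classes \<^term>\<open>p\<close> and
  \<^term>\<open>q\<close>, then at most one of these degrees comes from \<open>dz\<^sub>k\<close>. Hence its coefficient
  contains a variable of one of these classes, and it vanishes on every axis that belongs to neither.
\<close>

lemma form_vanishes_on_axis:
  fixes \<mu> :: "complex ^ 'n"
  assumes exp: "form_expansion \<mu> b \<omega> V a"
    and \<gamma>: "\<And>k \<alpha> \<rho>. \<alpha> \<in> V k \<Longrightarrow> class_degree \<kappa> k \<alpha> \<rho> = \<gamma> \<rho>"
    and pq: "\<gamma> p \<noteq> 0" "\<gamma> q \<noteq> 0" "p = q \<longrightarrow> \<gamma> p \<ge> 2" and i: "\<kappa> i \<noteq> p" "\<kappa> i \<noteq> q"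
  shows "\<omega> (axis i 1) = 0"
proof -
  have "monomial \<alpha> (axis i 1) = 0" if "\<alpha> \<in> V k" for k \<alpha>
  proof -
    define s where "s \<rho> = (\<Sum>j | \<kappa> j = \<rho>. \<alpha> j)" for \<rho>
    have "s \<rho> + (if \<kappa> k = \<rho> then 1 else 0) = \<gamma> \<rho>" for \<rho>
      using \<gamma>[OF that, of \<rho>] by (simp add: class_degree_def s_def)
    from this[of p] this[of q] have "s p \<noteq> 0 \<or> s q \<noteq> 0"
      using pq by (cases "p = q") (auto split: if_splits)
    then obtain j where "\<alpha> j \<noteq> 0" "\<kappa> j = p \<or> \<kappa> j = q"
      unfolding s_def by (metis (mono_tags, lifting) mem_Collect_eq sum.neutral)
    then show ?thesis
      using i by (intro monomial_eq_0[of \<alpha> j]) (auto simp: axis_def)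
  qed
  moreover have "axis i 1 \<in> (punctured :: (complex ^ 'n) set)"
    by (auto simp: punctured_def axis_eq_0_iff)
  ultimately show ?thesis
    using exp by (simp add: form_expansion_def vec_eq_iff)
qed

lemma sum_ge_2_witnesses:
  fixes \<gamma> :: "'n::finite \<Rightarrow> nat"
  assumes "2 \<le> (\<Sum>i\<in>UNIV. \<gamma> i)"
  obtains p q where "\<gamma> p \<noteq> 0" "\<gamma> q \<noteq> 0" "p = q \<longrightarrow> \<gamma> p \<ge> 2"
proof -
  have "(\<Sum>i\<in>UNIV. \<gamma> i) \<noteq> 0"
    using assms by linarith
  then obtain p where p: "\<gamma> p \<noteq> 0"
    by (meson sum.neutral)
  show thesis
  proof (cases "\<gamma> p \<ge> 2")
    case True
    then show ?thesis using that p by blast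
  next
    case False
    then have "(\<Sum>i\<in>UNIV - {p}. \<gamma> i) \<noteq> 0"
      using assms sum.remove[of UNIV p \<gamma>] by (simp only: finite UNIV_I)
    then obtain q where "q \<noteq> p" "\<gamma> q \<noteq> 0"
      by (metis DiffD2 insertCI sum.neutral)
    then show ?thesis using that p by metis
  qed
qed

text \<open>
  A total degree of two or more is carried by two classes, possibly equal, and a third class supplies
  an axis on which the form would vanish.
\<close>

lemma total_degree_one_three_classes:
  fixes \<mu> :: "complex ^ 'n"
  assumes exp: "form_expansion \<mu> b \<omega> V a" and nowhere: "\<And>z. z \<in> punctured \<Longrightarrow> \<omega> z \<noteq> 0"
    and \<gamma>: "\<And>k \<alpha> \<rho>. \<alpha> \<in> V k \<Longrightarrow> class_degree \<kappa> k \<alpha> \<rho> = \<gamma> \<rho>"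
    and three: "\<And>p q. \<exists>i. \<kappa> i \<noteq> p \<and> \<kappa> i \<noteq> q"
  shows "(\<Sum>\<rho>\<in>UNIV. \<gamma> \<rho>) \<le> 1"
proof (rule ccontr)
  assume "\<not> (\<Sum>\<rho>\<in>UNIV. \<gamma> \<rho>) \<le> 1"
  then have "2 \<le> (\<Sum>\<rho>\<in>UNIV. \<gamma> \<rho>)"
    by simp
  then obtain p q where pq: "\<gamma> p \<noteq> 0" "\<gamma> q \<noteq> 0" "p = q \<longrightarrow> \<gamma> p \<ge> 2"
    by (rule sum_ge_2_witnesses)
  obtain i where "\<kappa> i \<noteq> p" "\<kappa> i \<noteq> q"
    using three by blast
  then have "\<omega> (axis i 1) = 0"
    by (intro form_vanishes_on_axis[OF exp \<gamma> pq])
  then show False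
    using nowhere[of "axis i 1"] by (auto simp: punctured_def axis_eq_0_iff)
qed

lemma monomial_degree_one:
  assumes "(\<Sum>i\<in>UNIV. \<alpha> i) = 1"
  shows "\<exists>m. \<forall>z. monomial \<alpha> z = z $ m"
proof -
  from assms obtain m where m: "\<alpha> m = 1" "\<And>j. j \<noteq> m \<Longrightarrow> \<alpha> j = 0"
    by (metis UNIV_I finite sum_eq_1_iff)
  then have "monomial \<alpha> z = (\<Prod>i\<in>UNIV. if i = m then z $ i else 1)" for z
    unfolding monomial_def by (intro prod.cong) auto
  then show ?thesis by auto
qed

text \<open>
  Two classes, one of which is the single index \<^term>\<open>l\<close>. Suppose that the total
  degree is at least two. Unless the degree is one in both classes, the form vanishes on an axis as
  before. In the remaining case the components at
  \<open>dz\<^sub>k\<close> with \<^term>\<open>k \<noteq> l\<close> are multiples of \<open>z\<^sub>l\<close>, and the component at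
  \<open>dz\<^sub>l\<close> is a linear form in the variables of the other class. That class has at least two
  elements, \<^term>\<open>f\<close> and \<^term>\<open>u\<close>, so the linear form has a nontrivial zero with
  vanishing coordinate at \<^term>\<open>l\<close>.

  The single index is essential: for two classes of two variables each,
  \<open>z\<^sub>3 dz\<^sub>1 + z\<^sub>4 dz\<^sub>2 + z\<^sub>1 dz\<^sub>3 + z\<^sub>2 dz\<^sub>4\<close> has degree one in both
  classes and vanishes only at the origin.
\<close>

lemma total_degree_one_two_classes:
  fixes \<mu> :: "complex ^ 'n"
  assumes exp: "form_expansion \<mu> b \<omega> V a" and nowhere: "\<And>z. z \<in> punctured \<Longrightarrow> \<omega> z \<noteq> 0"
    and \<gamma>: "\<And>k \<alpha> \<rho>. \<alpha> \<in> V k \<Longrightarrow> class_degree \<kappa> k \<alpha> \<rho> = \<gamma> \<rho>"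
    and \<kappa>: "\<And>i. \<kappa> i = (if i = l then l else f)" and distinct: "f \<noteq> l" "u \<noteq> f" "u \<noteq> l"
  shows "(\<Sum>\<rho>\<in>UNIV. \<gamma> \<rho>) \<le> 1"
proof (rule ccontr)
  assume "\<not> (\<Sum>\<rho>\<in>UNIV. \<gamma> \<rho>) \<le> 1"
  have axis_nonzero: "\<omega> (axis i 1) \<noteq> 0" for i
    by (rule nowhere) (auto simp: punctured_def axis_eq_0_iff)
  obtain k\<^sub>0 \<alpha>\<^sub>0 where "\<alpha>\<^sub>0 \<in> V k\<^sub>0"
    using form_expansion_nonempty[OF exp nowhere] .
  moreover have "range \<kappa> \<subseteq> {f, l}"
    using \<kappa> by auto
  ultimately have "\<gamma> \<rho> = 0" if "\<rho> \<notin> {f, l}" for \<rho>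
  proof -
    have "class_degree \<kappa> k\<^sub>0 \<alpha>\<^sub>0 \<rho> = 0"
      using \<open>range \<kappa> \<subseteq> {f, l}\<close> that by (intro class_degree_outside) blast
    then show ?thesis
      using \<gamma>[OF \<open>\<alpha>\<^sub>0 \<in> V k\<^sub>0\<close>] by simp
  qed
  then have "(\<Sum>\<rho>\<in>UNIV. \<gamma> \<rho>) = (\<Sum>\<rho>\<in>{f, l}. \<gamma> \<rho>)"
    by (intro sum.mono_neutral_right) auto
  then have "2 \<le> \<gamma> f + \<gamma> l"
    using \<open>\<not> (\<Sum>\<rho>\<in>UNIV. \<gamma> \<rho>) \<le> 1\<close> distinct by simp
  moreover have "\<not> 2 \<le> \<gamma> f"
    using form_vanishes_on_axis[OF exp \<gamma>, of f f l] axis_nonzero[of l] distinct \<kappa>[of l] by auto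
  moreover have "\<not> 2 \<le> \<gamma> l"
    using form_vanishes_on_axis[OF exp \<gamma>, of l l f] axis_nonzero[of f] distinct \<kappa>[of f] by auto
  ultimately have one: "\<gamma> f = 1" "\<gamma> l = 1"
    by auto
  have "{i. \<kappa> i = l} = {l}"
    using \<kappa> distinct by auto
  then have exponent_l: "\<alpha> l = (if k = l then 0 else 1)" if "\<alpha> \<in> V k" for k \<alpha>
    using \<gamma>[OF that, of l] one \<kappa>[of k] distinct by (auto simp: class_degree_def split: if_splits)
  have "\<exists>m. \<forall>z. monomial \<alpha> z = z $ m" if "\<alpha> \<in> V l" for \<alpha>
  proof (rule monomial_degree_one)
    have "(\<Sum>\<rho>\<in>UNIV. class_degree \<kappa> l \<alpha> \<rho>) = 2"
      using \<gamma>[OF that] \<open>(\<Sum>\<rho>\<in>UNIV. \<gamma> \<rho>) = (\<Sum>\<rho>\<in>{f, l}. \<gamma> \<rho>)\<close> one distinct by simp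
    then show "(\<Sum>i\<in>UNIV. \<alpha> i) = 1"
      by (simp add: sum_class_degree)
  qed
  then obtain m where m: "\<And>\<alpha> z. \<alpha> \<in> V l \<Longrightarrow> monomial \<alpha> z = z $ m \<alpha>"
    by metis
  define L where "L z = (\<Sum>\<alpha>\<in>V l. a l \<alpha> * z $ m \<alpha>)" for z
  have L: "\<omega> z $ l = L z" if "z \<in> punctured" for z
    using exp that by (simp add: form_expansion_def L_def m)
  have L_linear: "L (x *s v + y *s w) = x * L v + y * L w" for x y v w
    by (simp add: L_def sum_distrib_left sum.distrib algebra_simps)
  \<comment> \<open>On the plane of the coordinates \<^term>\<open>f\<close> and \<^term>\<open>u\<close> only the linear form survives.\<close>
  have "\<exists>x y. (x \<noteq> 0 \<or> y \<noteq> 0) \<and> x * L (axis f 1) + y * L (axis u 1) = 0"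
  proof (cases "L (axis f 1) = 0")
    case True
    then show ?thesis by (intro exI[of _ 1] exI[of _ 0]) simp
  next
    case False
    then show ?thesis
      by (intro exI[of _ "L (axis u 1)"] exI[of _ "- L (axis f 1)"]) simp
  qed
  then obtain x y where xy: "x \<noteq> 0 \<or> y \<noteq> 0" "x * L (axis f 1) + y * L (axis u 1) = 0"
    by blast
  define z where "z = x *s axis f 1 + y *s (axis u 1 :: complex ^ 'n)"
  have "z $ f = x" "z $ u = y" "z $ l = 0"
    using distinct by (auto simp: z_def axis_def)
  with xy(1) have "z \<in> punctured"
    by (auto simp: punctured_def)
  moreover have "\<omega> z $ k = 0" for k
  proof (cases "k = l")
    case True
    then show ?thesis
      using L[OF \<open>z \<in> punctured\<close>] xy(2) by (simp add: z_def L_linear)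
  next
    case False
    then have "monomial \<alpha> z = 0" if "\<alpha> \<in> V k" for \<alpha>
      using exponent_l[OF that] \<open>z $ l = 0\<close> by (intro monomial_eq_0[of \<alpha> l]) auto
    then show ?thesis
      using exp \<open>z \<in> punctured\<close> by (simp add: form_expansion_def)
  qed
  ultimately show False
    using nowhere by (auto simp: vec_eq_iff)
qed

text \<open>
  The factor \<open>dz\<^sub>k\<close> already accounts for degree one, so no variable is left for the
  coefficients.
\<close>

lemma constant_form_if_total_degree_one:
  fixes \<mu> :: "complex ^ 'n"
  assumes exp: "form_expansion \<mu> b \<omega> V a"
    and \<gamma>: "\<And>k \<alpha> \<rho>. \<alpha> \<in> V k \<Longrightarrow> class_degree \<kappa> k \<alpha> \<rho> = \<gamma> \<rho>"
    and one: "(\<Sum>\<rho>\<in>UNIV. \<gamma> \<rho>) \<le> 1"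
  shows "\<And>k. V k \<noteq> {} \<Longrightarrow> inverse b = \<mu> $ k"
    and "\<And>k. V k \<noteq> {} \<Longrightarrow> \<gamma> (\<kappa> k) = 1"
    and "\<And>z. z \<in> punctured \<Longrightarrow> \<omega> z = (\<chi> k. \<Sum>\<alpha>\<in>V k. a k \<alpha>)"
proof -
  have zero: "\<alpha> i = 0" if "\<alpha> \<in> V k" for k \<alpha> i
  proof -
    have "(\<Sum>i\<in>UNIV. \<alpha> i) = 0"
      using one sum_class_degree[of \<kappa> k \<alpha>] \<gamma>[OF that] by simp
    then show ?thesis by simp
  qed
  then have monomial: "monomial \<alpha> z = 1" if "\<alpha> \<in> V k" for k \<alpha> z
    using zero[OF that] by (simp add: monomial_def)
  show "inverse b = \<mu> $ k" if "V k \<noteq> {}" for k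
  proof -
    obtain \<alpha> where "\<alpha> \<in> V k" using \<open>V k \<noteq> {}\<close> by blast
    then have "\<mu> $ k * monomial \<alpha> \<mu> = inverse b"
      using exp by (auto simp: form_expansion_def)
    then show ?thesis
      using monomial[OF \<open>\<alpha> \<in> V k\<close>] by simp
  qed
  show "\<gamma> (\<kappa> k) = 1" if "V k \<noteq> {}" for k
  proof -
    obtain \<alpha> where "\<alpha> \<in> V k" using \<open>V k \<noteq> {}\<close> by blast
    then have "class_degree \<kappa> k \<alpha> (\<kappa> k) = \<gamma> (\<kappa> k)" by (rule \<gamma>)
    then show ?thesis
      using zero[OF \<open>\<alpha> \<in> V k\<close>] by (simp add: class_degree_def)
  qed
  show "\<omega> z = (\<chi> k. \<Sum>\<alpha>\<in>V k. a k \<alpha>)" if "z \<in> punctured" for z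
    using exp that monomial by (simp add: form_expansion_def vec_eq_iff)
qed

section \<open>Classical, generic and intermediary Hopf manifolds\<close>

lemma homogeneous_polynomial_sum_monomial:
  fixes a :: "('n::finite \<Rightarrow> nat) \<Rightarrow> complex"
  assumes "\<And>\<alpha>. \<alpha> \<in> V \<Longrightarrow> (\<Sum>i\<in>UNIV. \<alpha> i) = d"
  shows "homogeneous_polynomial d (\<lambda>z :: complex ^ 'n. \<Sum>\<alpha>\<in>V. a \<alpha> * monomial \<alpha> z)"
proof -
  let ?D = "{\<alpha> :: 'n \<Rightarrow> nat. (\<Sum>i\<in>UNIV. \<alpha> i) = d}"
  have "\<alpha> i \<le> d" if "\<alpha> \<in> ?D" for \<alpha> i
    using that member_le_sum[of i UNIV \<alpha>] by simp
  then have "?D \<subseteq> UNIV \<rightarrow>\<^sub>E {..d}"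
    by auto
  then have "finite ?D"
    by (rule finite_subset) (auto intro: finite_PiE)
  have "(\<Sum>\<alpha>\<in>V. a \<alpha> * monomial \<alpha> z) =
      (\<Sum>\<alpha>\<in>?D. (if \<alpha> \<in> V then a \<alpha> else 0) * (\<Prod>i\<in>UNIV. (z $ i) ^ \<alpha> i))" for z :: "complex ^ 'n"
    by (rule sum.mono_neutral_cong_left) (use \<open>finite ?D\<close> assms in \<open>auto simp: monomial_def\<close>)
  then show ?thesis
    unfolding homogeneous_polynomial_def by (intro exI allI)
qed

text \<open>
  All terms have the same product of multipliers, a power of \<^term>\<open>\<mu>\<^sub>0\<close>, and
  \<^term>\<open>0 < norm \<mu>\<^sub>0 \<and> norm \<mu>\<^sub>0 < 1\<close> makes the exponent unique. The exponent exceeds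
  the degree of the coefficients by one because of the factor \<open>dz\<^sub>k\<close>. The form on the covering
  space is arbitrary at the origin, so it is replaced by its polynomial expression.
\<close>

lemma classical_case:
  fixes \<mu> :: "complex ^ 'n"
  assumes mult: "hopf_multipliers \<mu>" and ind: "induced_by \<mu> b F \<omega>"
    and exp: "form_expansion \<mu> b \<omega> V a" and classical: "classical_hopf \<mu> \<mu>\<^sub>0"
  shows "\<exists>m\<ge>1. inverse b = \<mu>\<^sub>0 ^ m \<and>
           (\<exists>g. induced_by \<mu> b F g \<and>
                (\<forall>i. homogeneous_polynomial (m - 1) (\<lambda>z. g z $ i)) \<and>
                {z. \<forall>i. g z $ i = 0} \<subseteq> {0} \<and>
                (m \<ge> 2 \<longrightarrow> {z. \<forall>i. g z $ i = 0} = {0}))"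
proof -
  have nowhere: "\<omega> z \<noteq> 0" if "z \<in> punctured" for z
    using ind that unfolding induced_by_def by blast
  have \<mu>\<^sub>0: "\<mu> $ i = \<mu>\<^sub>0" for i
    using classical by (simp add: classical_hopf_def)
  have power: "inverse b = \<mu>\<^sub>0 ^ Suc (\<Sum>i\<in>UNIV. \<alpha> i)" if "\<alpha> \<in> V k" for k \<alpha>
  proof -
    have "\<mu> $ k * monomial \<alpha> \<mu> = inverse b"
      using exp that unfolding form_expansion_def by blast
    then show ?thesis
      by (simp add: monomial_def \<mu>\<^sub>0 power_sum)
  qed
  obtain k\<^sub>0 \<alpha>\<^sub>0 where \<alpha>\<^sub>0: "\<alpha>\<^sub>0 \<in> V k\<^sub>0"
    using form_expansion_nonempty[OF exp nowhere] .
  define d where "d = (\<Sum>i\<in>UNIV. \<alpha>\<^sub>0 i)"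
  have degree: "(\<Sum>i\<in>UNIV. \<alpha> i) = d" if "\<alpha> \<in> V k" for k \<alpha>
  proof -
    have "norm \<mu>\<^sub>0 ^ Suc (\<Sum>i\<in>UNIV. \<alpha> i) = norm \<mu>\<^sub>0 ^ Suc d"
      using power[OF that] power[OF \<alpha>\<^sub>0] by (metis d_def norm_power)
    moreover have "norm \<mu>\<^sub>0 > 0" "norm \<mu>\<^sub>0 \<noteq> 1"
      using mult \<mu>\<^sub>0[of k] unfolding hopf_multipliers_def by (metis order_less_irrefl)+
    ultimately show ?thesis
      by (metis Power.power_inject_exp' Suc_inject)
  qed
  define g :: "complex ^ 'n \<Rightarrow> complex ^ 'n" where "g z = (\<chi> k. \<Sum>\<alpha>\<in>V k. a k \<alpha> * monomial \<alpha> z)" for z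
  have g: "\<omega> z = g z" if "z \<in> punctured" for z
    using exp that by (simp add: g_def form_expansion_def vec_eq_iff)
  have zeros: "{z. \<forall>i. g z $ i = 0} \<subseteq> {0}"
  proof
    fix z assume "z \<in> {z. \<forall>i. g z $ i = 0}"
    then have "g z = 0" by (simp add: vec_eq_iff)
    then show "z \<in> {0}"
      using nowhere[of z] g[of z] by (auto simp: punctured_def)
  qed
  have "g 0 = 0" if "d \<noteq> 0"
  proof -
    have "monomial \<alpha> 0 = 0" if \<alpha>: "\<alpha> \<in> V k" for k \<alpha>
    proof -
      have "(\<Sum>i\<in>UNIV. \<alpha> i) \<noteq> 0"
        using degree[OF \<alpha>] \<open>d \<noteq> 0\<close> by linarith
      then obtain i where "\<alpha> i \<noteq> 0"
        by (meson sum.neutral)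
      then show ?thesis by (rule monomial_eq_0) simp
    qed
    then show ?thesis by (simp add: g_def vec_eq_iff)
  qed
  then have "{z. \<forall>i. g z $ i = 0} = {0}" if "Suc d \<ge> 2"
    using zeros that by auto
  moreover have "homogeneous_polynomial (Suc d - 1) (\<lambda>z. g z $ i)" for i
    using degree by (simp add: g_def homogeneous_polynomial_sum_monomial)
  moreover have "induced_by \<mu> b F g"
    by (rule induced_by_cong[OF mult ind g])
  moreover have "inverse b = \<mu>\<^sub>0 ^ Suc d"
    unfolding d_def by (rule power[OF \<alpha>\<^sub>0])
  ultimately show ?thesis
    using zeros by (intro exI[of _ "Suc d"] conjI exI[of _ g]) auto
qed

text \<open>
  Every index is a class of its own. A total degree of one is concentrated at a single index, so only
  one component survives, and a constant factor does not change the kernels.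
\<close>

lemma generic_case:
  fixes \<mu> :: "complex ^ 'n::{finite,linorder}"
  assumes mult: "hopf_multipliers \<mu>" and "CARD('n) \<ge> 3" and ind: "induced_by \<mu> b F \<omega>"
    and exp: "form_expansion \<mu> b \<omega> V a" and generic: "generic_hopf \<mu>"
  shows "\<exists>j. inverse b = \<mu> $ j \<and> induced_by \<mu> b F (\<lambda>z. axis j 1)"
proof -
  note nonzero = hopf_multipliers_nonzero[OF mult]
  have nowhere: "\<omega> z \<noteq> 0" if "z \<in> punctured" for z
    using ind that unfolding induced_by_def by blast
  obtain \<gamma> where \<gamma>: "\<And>k \<alpha> \<rho>. \<alpha> \<in> V k \<Longrightarrow> class_degree (\<lambda>i. i) k \<alpha> \<rho> = \<gamma> \<rho>"
    using form_expansion_class_degree[OF nonzero exp, of "\<lambda>i. i"] generic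
    by (auto simp: generic_hopf_def)
  have "\<exists>i. i \<noteq> p \<and> i \<noteq> q" for p q :: 'n
  proof (rule ccontr)
    assume "\<not> ?thesis"
    then have "UNIV = {p, q}" by auto
    then have "CARD('n) \<le> 2"
      using card_insert_le_m1[of 2 "{q}" p] by simp
    then show False using \<open>CARD('n) \<ge> 3\<close> by simp
  qed
  then have one: "(\<Sum>\<rho>\<in>UNIV. \<gamma> \<rho>) \<le> 1"
    by (intro total_degree_one_three_classes[OF exp nowhere \<gamma>])
  have const_form:
    "\<And>k. V k \<noteq> {} \<Longrightarrow> inverse b = \<mu> $ k"
    "\<And>k. V k \<noteq> {} \<Longrightarrow> \<gamma> k = 1"
    "\<And>z. z \<in> punctured \<Longrightarrow> \<omega> z = (\<chi> k. \<Sum>\<alpha>\<in>V k. a k \<alpha>)"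
    using constant_form_if_total_degree_one[where \<kappa> = "\<lambda>i. i", OF exp \<gamma> one] by blast+
  obtain j \<alpha> where "\<alpha> \<in> V j"
    using form_expansion_nonempty[OF exp nowhere] .
  then have "V j \<noteq> {}" by auto
  have only: "V k = {}" if "k \<noteq> j" for k
  proof (rule ccontr)
    assume "V k \<noteq> {}"
    then have "\<gamma> k = 1" "\<gamma> j = 1"
      using const_form(2) \<open>V j \<noteq> {}\<close> by auto
    moreover have "\<gamma> j + \<gamma> k \<le> (\<Sum>\<rho>\<in>UNIV. \<gamma> \<rho>)"
      using sum_mono2[of UNIV "{j, k}" \<gamma>] that by simp
    ultimately show False using one by simp
  qed
  define c where "c = (\<Sum>\<alpha>\<in>V j. a j \<alpha>)"
  have \<omega>: "\<omega> z = c *s axis j 1" if "z \<in> punctured" for z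
    using const_form(3)[OF that] only by (auto simp: vec_eq_iff axis_def c_def)
  have b: "inverse b = \<mu> $ j"
    using const_form(1) \<open>V j \<noteq> {}\<close> by blast
  have "axis j 1 \<in> (punctured :: (complex, 'n) vec set)"
    by (simp add: punctured_def axis_eq_0_iff)
  then have "c \<noteq> 0"
    using nowhere \<omega> by force
  have scale: "covector_apply (c *s \<xi>) v = c * covector_apply \<xi> v" for \<xi> v :: "(complex, 'n) vec"
    by (simp add: covector_apply_def sum_distrib_left mult.assoc)
  have "F = {tangent_pt \<mu> z v | z v. z \<in> punctured \<and> covector_apply (axis j 1) v = 0}"
  proof -
    have "z \<in> punctured \<and> covector_apply (\<omega> z) v = 0 \<longleftrightarrow>
        z \<in> punctured \<and> covector_apply (axis j 1) v = 0" for z v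
      using \<omega> \<open>c \<noteq> 0\<close> by (auto simp: scale)
    moreover have "F = {tangent_pt \<mu> z v | z v. z \<in> punctured \<and> covector_apply (\<omega> z) v = 0}"
      using ind unfolding induced_by_def by blast
    ultimately show ?thesis by simp
  qed
  moreover have "holomorphic_map_on (\<lambda>z :: (complex, 'n) vec. axis j 1 :: (complex, 'n) vec) punctured"
    unfolding holomorphic_map_on_def by (intro ballI exI[of _ "\<lambda>v. 0"]) auto
  moreover have "axis j 1 $ k = inverse (\<mu> $ k) * inverse b * axis j 1 $ k" for k
    using nonzero by (simp add: b axis_def)
  moreover have "axis j 1 \<noteq> (0 :: (complex, 'n) vec)"
    by (simp add: axis_eq_0_iff)
  ultimately have "induced_by \<mu> b F (\<lambda>z. axis j 1)"
    unfolding induced_by_def by blast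
  with b show ?thesis by blast
qed

lemma bij_betw_index_number:
  "bij_betw index_number (UNIV :: 'n::{finite,linorder} set) {1..CARD('n)}"
proof -
  have strict: "index_number i < index_number j" if "i < j" for i j :: 'n
  proof -
    have "{k. k \<le> i} \<subseteq> {k. k \<le> j}" "j \<in> {k. k \<le> j} - {k. k \<le> i}"
      using that by auto
    then show ?thesis
      unfolding index_number_def by (intro psubset_card_mono) auto
  qed
  have inj: "inj (index_number :: 'n \<Rightarrow> nat)"
    by (rule injI) (metis linorder_neqE strict order_less_irrefl)
  have "index_number i \<in> {1..CARD('n)}" for i :: 'n
    unfolding index_number_def by (auto simp: card_gt_0_iff Suc_le_eq intro: card_mono)
  then have "range (index_number :: 'n \<Rightarrow> nat) = {1..CARD('n)}"
    using card_image[OF inj] by (intro card_subset_eq) auto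
  then show ?thesis
    using inj by (simp add: bij_betw_def)
qed

text \<open>
  The first \<^term>\<open>r\<close> indices form one class, represented by the first of them; the other
  classes are single indices. There are two classes if \<^term>\<open>r\<close> is one less than the dimension,
  and at least three otherwise.
\<close>

lemma intermediary_case:
  fixes \<mu> :: "complex ^ 'n::{finite,linorder}"
  assumes mult: "hopf_multipliers \<mu>" and "CARD('n) \<ge> 3" and ind: "induced_by \<mu> b F \<omega>"
    and exp: "form_expansion \<mu> b \<omega> V a" and inter: "intermediary_hopf \<mu> r"
  shows "inverse b \<in> {\<mu> $ i | i. i \<in> reduced_indices r} \<and> (\<exists>c. induced_by \<mu> b F (\<lambda>z. c))"
proof -
  let ?n = "index_number :: 'n \<Rightarrow> nat"
  note nonzero = hopf_multipliers_nonzero[OF mult]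
  have nowhere: "\<omega> z \<noteq> 0" if "z \<in> punctured" for z
    using ind that unfolding induced_by_def by blast
  have r: "2 \<le> r" "r \<le> CARD('n) - 1"
    and equal: "\<And>i j. ?n i \<le> r \<Longrightarrow> ?n j \<le> r \<Longrightarrow> \<mu> $ i = \<mu> $ j"
    and rel: "no_nontrivial_relation \<mu> (reduced_indices r)"
    using inter unfolding intermediary_hopf_def by blast+
  have bij: "bij_betw ?n UNIV {1..CARD('n)}"
    by (rule bij_betw_index_number)
  have inj: "?n i = ?n j \<Longrightarrow> i = j" for i j
    using bij by (auto simp: bij_betw_def dest: injD)
  have surj: "\<exists>i. ?n i = k" if "1 \<le> k" "k \<le> CARD('n)" for k
    using bij that unfolding bij_betw_def
    by (metis atLeastAtMost_iff imageE)
  have range: "1 \<le> ?n i" "?n i \<le> CARD('n)" for i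
    using bij_betw_apply[OF bij, of i] by auto
  obtain f where f: "?n f = 1"
    using surj[of 1] \<open>CARD('n) \<ge> 3\<close> by auto
  obtain l where l: "?n l = CARD('n)"
    using surj[of "CARD('n)"] \<open>CARD('n) \<ge> 3\<close> by auto
  obtain u where u: "?n u = CARD('n) - 1"
    using surj[of "CARD('n) - 1"] \<open>CARD('n) \<ge> 3\<close> by fastforce
  have distinct: "f \<noteq> l" "u \<noteq> f" "u \<noteq> l"
    using f l u \<open>CARD('n) \<ge> 3\<close> by auto
  define \<kappa> where "\<kappa> i = (if ?n i \<le> r then f else i)" for i
  have "range \<kappa> = reduced_indices r"
  proof
    show "range \<kappa> \<subseteq> reduced_indices r"
      using f by (auto simp: \<kappa>_def reduced_indices_def)
    show "reduced_indices r \<subseteq> range \<kappa>"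
    proof
      fix i :: 'n assume "i \<in> reduced_indices r"
      then have "\<kappa> i = i"
        using f r inj[of i f] by (auto simp: \<kappa>_def reduced_indices_def)
      then show "i \<in> range \<kappa>" by (metis rangeI)
    qed
  qed
  have classes: "\<mu> $ i = \<mu> $ \<kappa> i" for i
    using f r by (auto simp: \<kappa>_def intro: equal)
  obtain \<gamma> where \<gamma>: "\<And>k \<alpha> \<rho>. \<alpha> \<in> V k \<Longrightarrow> class_degree \<kappa> k \<alpha> \<rho> = \<gamma> \<rho>"
    using form_expansion_class_degree[OF nonzero exp classes] rel \<open>range \<kappa> = reduced_indices r\<close> by metis
  have one: "(\<Sum>\<rho>\<in>UNIV. \<gamma> \<rho>) \<le> 1"
  proof (cases "r = CARD('n) - 1")
    case True
    have "\<kappa> i = (if i = l then l else f)" for i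
    proof -
      have "?n i \<le> r \<longleftrightarrow> i \<noteq> l"
      proof (cases "i = l")
        case False
        then have "?n i \<noteq> CARD('n)"
          using inj[of i l] l by auto
        then have "?n i \<le> r"
          using range(2)[of i] True by linarith
        with False show ?thesis by simp
      qed (use l True \<open>CARD('n) \<ge> 3\<close> in simp)
      then show ?thesis by (simp add: \<kappa>_def)
    qed
    then show ?thesis
      using distinct by (intro total_degree_one_two_classes[OF exp nowhere \<gamma>])
  next
    case False
    have fixed: "\<kappa> f = f" "\<kappa> u = u" "\<kappa> l = l"
      using False r u l by (auto simp: \<kappa>_def)
    show ?thesis
    proof (rule total_degree_one_three_classes[OF exp nowhere \<gamma>])
      fix p q
      show "\<exists>i. \<kappa> i \<noteq> p \<and> \<kappa> i \<noteq> q"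
        using fixed distinct by metis
    qed
  qed
  have const_form:
    "\<And>k. V k \<noteq> {} \<Longrightarrow> inverse b = \<mu> $ k"
    "\<And>k. V k \<noteq> {} \<Longrightarrow> \<gamma> (\<kappa> k) = 1"
    "\<And>z. z \<in> punctured \<Longrightarrow> \<omega> z = (\<chi> k. \<Sum>\<alpha>\<in>V k. a k \<alpha>)"
    using constant_form_if_total_degree_one[where \<kappa> = \<kappa>, OF exp \<gamma> one] by blast+
  obtain k \<alpha> where "\<alpha> \<in> V k"
    using form_expansion_nonempty[OF exp nowhere] .
  then have "inverse b = \<mu> $ \<kappa> k"
    using const_form(1)[of k] classes[of k] by auto
  moreover have "\<kappa> k \<in> reduced_indices r"
    using \<open>range \<kappa> = reduced_indices r\<close> by blast
  moreover have "induced_by \<mu> b F (\<lambda>z. \<chi> k. \<Sum>\<alpha>\<in>V k. a k \<alpha>)"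
    by (rule induced_by_cong[OF mult ind const_form(3)])
  ultimately show ?thesis by blast
qed

theorem theorem1p6:
  fixes \<mu> :: "complex ^ 'n::{finite,linorder}"
    and b :: complex
    and \<Phi> :: "((complex, 'n) vec \<times> complex) set \<Rightarrow> ((complex, 'n) vec \<times> (complex, 'n) vec) set"
    and F :: "((complex, 'n) vec \<times> (complex, 'n) vec) set set"
  assumes "CARD('n) \<ge> 3"
    and "hopf_multipliers \<mu>"
    and "b \<noteq> 0"
    and "distribution_given_by \<mu> b \<Phi> F"
  shows "(\<forall>\<mu>\<^sub>0. classical_hopf \<mu> \<mu>\<^sub>0 \<longrightarrow>
            (\<exists>m\<ge>1. inverse b = \<mu>\<^sub>0 ^ m \<and>
               (\<exists>g. induced_by \<mu> b F g \<and>
                    (\<forall>i. homogeneous_polynomial (m - 1) (\<lambda>z. g z $ i)) \<and>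
                    {z. \<forall>i. g z $ i = 0} \<subseteq> {0} \<and>
                    (m \<ge> 2 \<longrightarrow> {z. \<forall>i. g z $ i = 0} = {0}))))
       \<and> (generic_hopf \<mu> \<longrightarrow>
            (\<exists>j. inverse b = \<mu> $ j \<and> induced_by \<mu> b F (\<lambda>z. axis j 1)))
       \<and> (\<forall>r. intermediary_hopf \<mu> r \<longrightarrow>
            inverse b \<in> {\<mu> $ i | i. i \<in> reduced_indices r} \<and>
            (\<exists>c. induced_by \<mu> b F (\<lambda>z. c)))"
proof -
  obtain \<omega> where ind: "induced_by \<mu> b F \<omega>"
    using inducing_form_exists[OF assms(2,3,4)] by blast
  have "CARD('n) \<ge> 2"
    using assms(1) by simp
  then obtain V a where exp: "form_expansion \<mu> b \<omega> V a"
    using form_expansion_exists[OF assms(2) _ assms(3) ind] by blast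
  show ?thesis
    using classical_case[OF assms(2) ind exp] generic_case[OF assms(2,1) ind exp]
      intermediary_case[OF assms(2,1) ind exp]
    by blast
qed

end
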